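(* Let $p$ be a prime, $k$ a commutative ring of characteristic $p$ (i.e. $\mathbb F_p\subset k$), $R=k[x_1,\dots,x_d]$ and $I\subset R$ an ideal. Let $l\ge 1$ be an integer and let $D\in\mathrm{HS}_k(R;p^l)$ be a $(p^l-1)$-$I$-logarithmic Hasse-Schmidt derivation with $\ell(D)>1$. Then there exist $F\in\mathrm{HS}_k(\log I;p^l)$ with $\ell(F)>1$ and a $(p^{l-1}-1)$-$I$-logarithmic Hasse-Schmidt derivation $T\in\mathrm{HS}_k(R;p^{l-1})$ such that $$D=T[p]\circ F.$$
   Context: For a commutative ring $k$, a commutative $k$-algebra $A$ and an integer $m\ge 1$, $\mathrm{HS}_k(A;m)$ is the set of Hasse-Schmidt derivations of $A$ over $k$ of length $m$: sequences $D=(D_0,\dots,D_m)$ of $k$-linear maps $D_i:A\to A$ with $D_0=\mathrm{Id}_A$ and $D_n(xy)=\sum_{i+j=n}D_i(x)D_j(y)$ for all $x,y\in A$, $n\le m$. It is a group under $(D\circ D')_n=\sum_{i+j=n}D_i\circ D'_j$, with identity $\mathbb I=(\mathrm{Id},0,\dots,0)$. For $D\ne\mathbb I$, $\ell(D)=\min\{h\ge1\mid D_h\neq0\}$, and $\ell(\mathbb I)=\infty$. For an ideal $I\subseteq A$, $\mathrm{HS}_k(\log I;m)$ is the set of $I$-logarithmic $D\in\mathrm{HS}_k(A;m)$, i.e. with $D_i(I)\subseteq I$ for all $i\le m$; for $r\le m$, $D\in\mathrm{HS}_k(A;m)$ is $r$-$I$-logarithmic if $D_i(I)\subseteq I$ for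 all $i\le r$ (vacuous for $r=0$). For $D\in\mathrm{HS}_k(A;m)$ and $n\ge1$, $D[n]\in\mathrm{HS}_k(A;nm)$ is given by $D[n]_i=D_{i/n}$ if $n\mid i$ and $D[n]_i=0$ otherwise. *)

theory Defs
  imports
    "HOL-Library.Poly_Mapping"
    "HOL-Library.Extended_Nat"
    "HOL-Computational_Algebra.Primes"
begin

(* k[x_1,...,x_d] with d = CARD('n): finitely supported families of coefficients indexed by
   exponent vectors; multiplication is the convolution product of Poly_Mapping. *)
type_synonym ('n, 'k) mvpoly = "('n \<Rightarrow>\<^sub>0 nat) \<Rightarrow>\<^sub>0 'k"

definition poly_scale :: "'k::comm_ring_1 \<Rightarrow> ('n, 'k) mvpoly \<Rightarrow> ('n, 'k) mvpoly" where
  "poly_scale c f = Poly_Mapping.single 0 c * f"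

lemma module_poly_scale: "module poly_scale"
  by unfold_locales (simp_all add: poly_scale_def distrib_left distrib_right single_add
      mult.assoc [symmetric] mult_single)

lemma poly_scale_mult_left: "poly_scale c f * g = poly_scale c (f * g)"
  by (simp add: poly_scale_def mult.assoc)

(* An ideal is a submodule of the ring regarded as a module over itself. *)
definition is_ideal :: "'a::comm_ring_1 set \<Rightarrow> bool" where
  "is_ideal I \<longleftrightarrow> module.subspace (*) I"

lemma is_ideal_iff:
  "is_ideal I \<longleftrightarrow>
    0 \<in> I \<and> (\<forall>x\<in>I. \<forall>y\<in>I. x + y \<in> I) \<and> (\<forall>c. \<forall>x\<in>I. c * x \<in> I)"
proof -
  interpret module "(*) :: 'a \<Rightarrow> 'a \<Rightarrow> 'a"
    by unfold_locales (simp_all add: algebra_simps)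
  show ?thesis
    by (simp add: is_ideal_def subspace_def)
qed

(* A sequence (D_0,...,D_m) is encoded as a function on nat whose entries beyond m are zero,
   so that two sequences of length m are equal iff the encoding functions are.
   The parameter s is the scalar multiplication of the k-algebra. *)
definition HS :: "('k::comm_ring_1 \<Rightarrow> 'a::comm_ring_1 \<Rightarrow> 'a) \<Rightarrow> nat \<Rightarrow> (nat \<Rightarrow> 'a \<Rightarrow> 'a) set" where
  "HS s m = {D.
     (\<forall>i\<le>m. module_hom s s (D i)) \<and>
     D 0 = id \<and>
     (\<forall>n\<le>m. \<forall>x y. D n (x * y) = (\<Sum>i\<le>n. D i x * D (n - i) y)) \<and>
     (\<forall>i>m. D i = (\<lambda>_. 0))}"

definition hs_id :: "nat \<Rightarrow> 'a \<Rightarrow> 'a::comm_ring_1" where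
  "hs_id i = (if i = 0 then id else (\<lambda>_. 0))"

definition hs_comp ::
    "nat \<Rightarrow> (nat \<Rightarrow> 'a \<Rightarrow> 'a) \<Rightarrow> (nat \<Rightarrow> 'a \<Rightarrow> 'a) \<Rightarrow> nat \<Rightarrow> 'a \<Rightarrow> 'a::comm_ring_1" where
  "hs_comp m D E n = (if n \<le> m then (\<lambda>x. \<Sum>i\<le>n. D i (E (n - i) x)) else (\<lambda>_. 0))"

definition hs_ell :: "(nat \<Rightarrow> 'a \<Rightarrow> 'a::comm_ring_1) \<Rightarrow> enat" where
  "hs_ell D = (if D = hs_id then \<infinity> else enat (LEAST h. 1 \<le> h \<and> D h \<noteq> (\<lambda>_. 0)))"

definition logarithmic_upto :: "nat \<Rightarrow> 'a set \<Rightarrow> (nat \<Rightarrow> 'a \<Rightarrow> 'a::comm_ring_1) \<Rightarrow> bool" where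
  "logarithmic_upto r I D \<longleftrightarrow> (\<forall>i\<le>r. D i ` I \<subseteq> I)"

definition HS_log ::
    "('k::comm_ring_1 \<Rightarrow> 'a::comm_ring_1 \<Rightarrow> 'a) \<Rightarrow> 'a set \<Rightarrow> nat \<Rightarrow> (nat \<Rightarrow> 'a \<Rightarrow> 'a) set" where
  "HS_log s I m = {D \<in> HS s m. logarithmic_upto m I D}"

(* D[n] in the usual notation; it has length n * m when D has length m and n >= 1. *)
definition hs_dilate :: "nat \<Rightarrow> (nat \<Rightarrow> 'a \<Rightarrow> 'a) \<Rightarrow> nat \<Rightarrow> 'a \<Rightarrow> 'a::comm_ring_1" where
  "hs_dilate n D i = (if n dvd i then D (i div n) else (\<lambda>_. 0))"

end

theory Submission
  imports Defs "HOL-Computational_Algebra.Formal_Power_Series" "HOL-Library.Product_Plus"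
    "HOL-Algebra.Exponent"
begin

text \<open>
  Over a polynomial ring every Hasse-Schmidt derivation extends to infinite length, so only
  logarithmicity depends on a length. If \<open>D\<close> is logarithmic below degree \<open>N\<close>, then \<open>D\<^sub>N\<close> induces a
  map \<open>I \<rightarrow> R/I\<close>, the obstruction of \<open>D\<close>, and obstructions add up under composition. Factoring
  two-variable derivations into one-variable ones \<open>E\<close> in which the variable is replaced by a
  monomial, one shows by induction on \<open>N\<close> that a leading term of degree \<open>n\<close> of a derivation
  logarithmic below \<open>N\<close> has an integral \<open>E\<close> such that \<open>E\<^sub>c\<close> preserves \<open>I\<close> for \<open>c n < N\<close>. The
  inductive step compares obstructions. For \<open>N = n p^e\<close> one reads off the coefficient at the
  multiple \<open>p^e \<alpha>\<close> of the leading exponent \<open>\<alpha>\<close>. For \<open>N = p^e m\<close> with \<open>m > 1\<close> prime to \<open>p\<close>, one uses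
  \<open>D(u + v)\<close>, whose obstruction at \<open>u^(p^e) v^(N - p^e)\<close> is that of \<open>D\<close> times a binomial
  coefficient that is invertible modulo \<open>p\<close>. For the theorem, in the factorization of \<open>D\<close> only
  the factors \<open>E[p^j]\<close>, \<open>j \<ge> 1\<close>, contribute to the obstruction at \<open>p^l\<close>; their
  product is \<open>T[p]\<close>.
\<close>

section \<open>Extension of Hasse-Schmidt derivations of polynomial rings\<close>

text \<open>A member is the coefficient sequence of an algebra homomorphism to R[[t]] that reduces
  to the identity at t = 0. With infinite length, composition and substitution need no
  truncation.\<close>

definition HS_inf :: "('k::comm_ring_1 \<Rightarrow> 'a::comm_ring_1 \<Rightarrow> 'a) \<Rightarrow> (nat \<Rightarrow> 'a \<Rightarrow> 'a) set" where
  "HS_inf s = {D. D 0 = id \<and> (\<forall>i. module_hom s s (D i)) \<and>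
     (\<forall>n x y. D n (x * y) = (\<Sum>i\<le>n. D i x * D (n - i) y))}"

lemma poly_mapping_sum_single: "f = (\<Sum>m\<in>Poly_Mapping.keys f. Poly_Mapping.single m (Poly_Mapping.lookup f m))"
proof (rule poly_mapping_eqI)
  fix k
  have "Poly_Mapping.lookup (\<Sum>m\<in>Poly_Mapping.keys f. Poly_Mapping.single m (Poly_Mapping.lookup f m)) k
      = (\<Sum>m\<in>Poly_Mapping.keys f. if m = k then Poly_Mapping.lookup f m else 0)"
    by (simp add: lookup_sum lookup_single when_def)
  also have "\<dots> = Poly_Mapping.lookup f k"
    by (simp add: in_keys_iff)
  finally show "Poly_Mapping.lookup f k =
      Poly_Mapping.lookup (\<Sum>m\<in>Poly_Mapping.keys f. Poly_Mapping.single m (Poly_Mapping.lookup f m)) k"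
    by simp
qed

section \<open>Evaluation homomorphisms and induction over the generators of a polynomial
  ring\<close>

definition mvpoly_eval :: "('k \<Rightarrow> 'b) \<Rightarrow> ('n \<Rightarrow> 'b) \<Rightarrow> ('n::finite, 'k::comm_ring_1) mvpoly \<Rightarrow> 'b::comm_ring_1"
  where "mvpoly_eval h a f =
    (\<Sum>m\<in>Poly_Mapping.keys f. h (Poly_Mapping.lookup f m) * (\<Prod>j\<in>UNIV. a j ^ Poly_Mapping.lookup m j))"

context
  fixes h :: "'k::comm_ring_1 \<Rightarrow> 'b::comm_ring_1" and a :: "'n::finite \<Rightarrow> 'b"
  assumes h_zero: "h 0 = 0" and h_one: "h 1 = 1"
    and h_add: "\<And>c d. h (c + d) = h c + h d" and h_mult: "\<And>c d. h (c * d) = h c * h d"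
begin

lemma mvpoly_eval_superset:
  assumes "finite S" "Poly_Mapping.keys f \<subseteq> S"
  shows "mvpoly_eval h a f =
    (\<Sum>m\<in>S. h (Poly_Mapping.lookup f m) * (\<Prod>j\<in>UNIV. a j ^ Poly_Mapping.lookup m j))"
  unfolding mvpoly_eval_def using assms
  by (intro sum.mono_neutral_left) (auto simp: in_keys_iff h_zero)

lemma mvpoly_eval_zero: "mvpoly_eval h a 0 = 0"
  by (simp add: mvpoly_eval_def)

lemma mvpoly_eval_add: "mvpoly_eval h a (f + g) = mvpoly_eval h a f + mvpoly_eval h a g"
proof -
  let ?S = "Poly_Mapping.keys f \<union> Poly_Mapping.keys g"
  have "Poly_Mapping.keys (f + g) \<subseteq> ?S"
    by (rule keys_add)
  then show ?thesis
    by (simp add: mvpoly_eval_superset [of ?S] lookup_add h_add distrib_right sum.distrib)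
qed

lemma mvpoly_eval_sum: "mvpoly_eval h a (\<Sum>i\<in>S. f i) = (\<Sum>i\<in>S. mvpoly_eval h a (f i))"
  by (induction S rule: infinite_finite_induct) (simp_all add: mvpoly_eval_zero mvpoly_eval_add)

lemma mvpoly_eval_single:
  "mvpoly_eval h a (Poly_Mapping.single m c) = h c * (\<Prod>j\<in>UNIV. a j ^ Poly_Mapping.lookup m j)"
  by (cases "c = 0") (simp_all add: mvpoly_eval_def h_zero)

lemma mvpoly_eval_mult: "mvpoly_eval h a (f * g) = mvpoly_eval h a f * mvpoly_eval h a g"
proof -
  let ?t = "\<lambda>f m. Poly_Mapping.single m (Poly_Mapping.lookup f m)"
  have "mvpoly_eval h a (f * g) = mvpoly_eval h a
      ((\<Sum>m\<in>Poly_Mapping.keys f. ?t f m) * (\<Sum>n\<in>Poly_Mapping.keys g. ?t g n))"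
    by (simp flip: poly_mapping_sum_single)
  also have "\<dots> = (\<Sum>m\<in>Poly_Mapping.keys f. \<Sum>n\<in>Poly_Mapping.keys g.
      mvpoly_eval h a (?t f m) * mvpoly_eval h a (?t g n))"
    by (simp add: sum_product mvpoly_eval_sum mult_single mvpoly_eval_single h_mult lookup_add
        power_add prod.distrib mult_ac)
  also have "\<dots> = mvpoly_eval h a (\<Sum>m\<in>Poly_Mapping.keys f. ?t f m) *
      mvpoly_eval h a (\<Sum>n\<in>Poly_Mapping.keys g. ?t g n)"
    by (simp add: mvpoly_eval_sum sum_product)
  finally show ?thesis
    by (simp flip: poly_mapping_sum_single)
qed

lemma mvpoly_eval_one: "mvpoly_eval h a 1 = 1"
  using mvpoly_eval_single [of 0 1] by (simp add: h_one)

lemma mvpoly_eval_var: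
  "mvpoly_eval h a (Poly_Mapping.single (Poly_Mapping.single j 1) 1) = a j"
proof -
  have "(\<Prod>i\<in>UNIV. a i ^ Poly_Mapping.lookup (Poly_Mapping.single j (1::nat)) i)
      = (\<Prod>i\<in>UNIV. if i = j then a j else 1)"
    by (intro prod.cong) (auto simp: lookup_single when_def)
  then show ?thesis
    by (simp add: mvpoly_eval_single h_one)
qed

end

text \<open>The variables generate the polynomial ring as an algebra; the rule reduces agreement of
  two Hasse-Schmidt derivations to their values on 1 and the variables.\<close>

lemma mvpoly_induct [case_names add mult scale one var]:
  fixes f :: "('n::finite, 'k::comm_ring_1) mvpoly"
  assumes add: "\<And>f g. P f \<Longrightarrow> P g \<Longrightarrow> P (f + g)"
    and mult: "\<And>f g. P f \<Longrightarrow> P g \<Longrightarrow> P (f * g)"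
    and scale: "\<And>c f. P f \<Longrightarrow> P (poly_scale c f)"
    and one: "P 1"
    and var: "\<And>j. P (Poly_Mapping.single (Poly_Mapping.single j 1) 1)"
  shows "P f"
proof -
  have zero: "P 0"
    using scale [OF one, of 0] by (simp add: poly_scale_def)
  have psum: "P (\<Sum>i\<in>S. F i)" if "\<And>i. i \<in> S \<Longrightarrow> P (F i)" for S :: "('n \<Rightarrow>\<^sub>0 nat) set" and F
    using that by (induction S rule: infinite_finite_induct) (auto intro: zero add)
  have pprod: "P (\<Prod>i\<in>S. F i)" if "\<And>i. i \<in> S \<Longrightarrow> P (F i)" for S :: "'n set" and F
    using that by (induction S rule: infinite_finite_induct) (auto intro: one mult)
  have ppow: "P (g ^ n)" if "P g" for g n
    using that by (induction n) (auto intro: one mult)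
  have pow_single: "Poly_Mapping.single (Poly_Mapping.single j 1) (1::'k) ^ n =
      Poly_Mapping.single (Poly_Mapping.single j n) 1" for j :: 'n and n
    by (induction n) (simp_all add: mult_single flip: single_add)
  have prod_single: "(\<Prod>i\<in>S. Poly_Mapping.single (F i) (1::'k)) = Poly_Mapping.single (\<Sum>i\<in>S. F i) 1"
    for S and F :: "'n \<Rightarrow> 'n \<Rightarrow>\<^sub>0 nat"
    by (induction S rule: infinite_finite_induct) (simp_all add: mult_single)
  have mono: "P (Poly_Mapping.single m c)" for m c
  proof -
    have msum: "m = (\<Sum>j\<in>UNIV. Poly_Mapping.single j (Poly_Mapping.lookup m j))"
      by (rule poly_mapping_eqI) (simp add: lookup_sum lookup_single when_def)
    have m: "Poly_Mapping.single m (1::'k) =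
        (\<Prod>j\<in>UNIV. Poly_Mapping.single (Poly_Mapping.single j 1) 1 ^ Poly_Mapping.lookup m j)"
      by (simp add: pow_single [simplified] prod_single flip: msum)
    have "Poly_Mapping.single m c = poly_scale c (Poly_Mapping.single m 1)"
      by (simp add: poly_scale_def mult_single)
    then show ?thesis
      unfolding m by (auto intro!: scale pprod ppow var [simplified])
  qed
  show ?thesis
    by (subst poly_mapping_sum_single) (auto intro!: psum mono)
qed

text \<open>Expanding \<open>D n (1 * 1)\<close> leaves, by induction, only the two extremal terms,
  so that \<open>D n 1 = D n 1 + D n 1\<close> for positive \<open>n\<close>.\<close>

lemma HS_one:
  assumes "D \<in> HS s m" "n \<le> m"
  shows "D n 1 = (if n = 0 then 1 else 0)"
  using assms(2)
proof (induction n rule: less_induct)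
  case (less n)
  show ?case
  proof (cases "n = 0")
    case False
    then obtain k where k: "n = Suc k"
      by (cases n) auto
    have D0: "D 0 = id"
      using assms by (auto simp: HS_def)
    have "D n (1 * 1) = (\<Sum>i\<le>n. D i 1 * D (n - i) 1)"
      using assms less.prems unfolding HS_def by blast
    also have "\<dots> = D n 1 + (\<Sum>i\<le>k. D i 1 * D (n - i) 1)"
      by (simp add: k D0)
    also have "(\<Sum>i\<le>k. D i 1 * D (n - i) 1) = (\<Sum>i\<le>k. if i = 0 then D n 1 else 0)"
      using less.IH less.prems k by (intro sum.cong) (auto simp: D0)
    finally show ?thesis
      using False by simp
  qed (use assms in \<open>auto simp: HS_def\<close>)
qed

text \<open>A derivation of length \<open>m\<close> is an algebra homomorphism to R[t]/(t^(m+1)). As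
  R is free on its variables, any lifts of their images to R[[t]] define a homomorphism, whose
  coefficients are the extension.\<close>

lemma HS_poly_extend:
  fixes D :: "nat \<Rightarrow> ('n::finite, 'k::comm_ring_1) mvpoly \<Rightarrow> ('n, 'k) mvpoly"
  assumes D: "D \<in> HS poly_scale m"
  obtains E where "E \<in> HS_inf poly_scale" "\<And>i. i \<le> m \<Longrightarrow> E i = D i"
proof -
  define h :: "'k \<Rightarrow> ('n, 'k) mvpoly fps" where "h c = fps_const (Poly_Mapping.single 0 c)" for c
  have h: "h 0 = 0" "h 1 = 1" "\<And>c d. h (c + d) = h c + h d" "\<And>c d. h (c * d) = h c * h d"
    by (simp_all add: h_def single_add mult_single)
  \<comment> \<open>The chosen lift of the image of a variable has zero coefficients beyond
    \<open>m\<close>, as \<open>HS\<close> prescribes for \<open>D\<close>.\<close>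
  define a where "a j = Abs_fps (\<lambda>i. D i (Poly_Mapping.single (Poly_Mapping.single j 1) 1))" for j
  let ?\<phi> = "mvpoly_eval h a"
  note hom = mvpoly_eval_add [OF h, of a] mvpoly_eval_mult [OF h, of a] mvpoly_eval_one [OF h, of a]
    mvpoly_eval_var [OF h, of a]
  have eval_scale: "?\<phi> (poly_scale c f) = h c * ?\<phi> f" for c f
    by (simp add: poly_scale_def hom mvpoly_eval_single [OF h])
  define E where "E i f = fps_nth (?\<phi> f) i" for i f
  \<comment> \<open>Up to degree \<open>m\<close> both families obey the same sum, scaling and
    product rules, so it suffices to compare them at 1 and at the variables.\<close>
  have eq: "\<forall>i\<le>m. E i f = D i f" for f
  proof (induction f rule: mvpoly_induct)
    case (add f g)
    then show ?case
      using D by (simp add: E_def hom HS_def module_hom_iff)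
  next
    case (mult f g)
    have "E i (f * g) = (\<Sum>j\<le>i. E j f * E (i - j) g)" for i
      by (simp add: E_def hom fps_mult_nth atLeast0AtMost)
    then show ?case
      using D mult by (simp add: HS_def)
  next
    case (scale c f)
    have "E i (poly_scale c f) = poly_scale c (E i f)" for i
      unfolding E_def eval_scale by (simp add: h_def poly_scale_def)
    then show ?case
      using D scale by (simp add: HS_def module_hom_iff)
  next
    case one
    then show ?case
      by (auto simp: E_def hom HS_one [OF D])
  next
    case (var j)
    then show ?case
      by (simp add: E_def hom(4) [simplified] a_def)
  qed
  have "E 0 = id"
    using eq D by (auto simp: HS_def)
  moreover have "module_hom poly_scale poly_scale (E i)" for i
    by (simp add: module_hom_iff module_poly_scale E_def hom eval_scale)
      (simp add: h_def poly_scale_def)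
  moreover have "E n (x * y) = (\<Sum>i\<le>n. E i x * E (n - i) y)" for n x y
    by (simp add: E_def hom fps_mult_nth atLeast0AtMost)
  ultimately have "E \<in> HS_inf poly_scale"
    by (simp add: HS_inf_def)
  then show thesis
    by (rule that) (use eq in auto)
qed

section \<open>Hasse-Schmidt derivations in two variables\<close>

definition antidiag :: "nat \<times> nat \<Rightarrow> ((nat \<times> nat) \<times> (nat \<times> nat)) set" where
  "antidiag n = {(i, j). i + j = n}"

definition tdeg :: "nat \<times> nat \<Rightarrow> nat" where
  "tdeg n = fst n + snd n"

definition smul :: "nat \<Rightarrow> nat \<times> nat \<Rightarrow> nat \<times> nat" where
  "smul c \<alpha> = (c * fst \<alpha>, c * snd \<alpha>)"

lemma antidiag_iff [simp]: "(i, j) \<in> antidiag n \<longleftrightarrow> i + j = n"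
  by (simp add: antidiag_def)

lemma finite_antidiag [simp]: "finite (antidiag n)"
proof (rule finite_subset)
  show "antidiag n \<subseteq> ({..fst n} \<times> {..snd n}) \<times> ({..fst n} \<times> {..snd n})"
    by (auto simp: antidiag_def)
qed simp

lemma tdeg_zero [simp]: "tdeg 0 = 0"
  by (simp add: tdeg_def)

lemma tdeg_add: "tdeg (i + j) = tdeg i + tdeg j"
  by (simp add: tdeg_def)

lemma tdeg_eq_0_iff [simp]: "tdeg n = 0 \<longleftrightarrow> n = 0"
  by (simp add: tdeg_def prod_eq_iff)

lemma tdeg_smul [simp]: "tdeg (smul c \<alpha>) = c * tdeg \<alpha>"
  by (simp add: tdeg_def smul_def distrib_left)

lemma tdeg_Pair [simp]: "tdeg (a, b) = a + b"
  by (simp add: tdeg_def)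

lemma smul_Pair [simp]: "smul c (a, b) = (c * a, c * b)"
  by (simp add: smul_def)

lemma smul_smul: "smul c (smul d \<alpha>) = smul (c * d) \<alpha>"
  by (simp add: smul_def)

lemma smul_add: "smul (c + d) \<alpha> = smul c \<alpha> + smul d \<alpha>"
  by (simp add: smul_def prod_eq_iff distrib_right)

lemma smul_0 [simp]: "smul 0 \<alpha> = 0"
  by (simp add: smul_def prod_eq_iff)

lemma smul_1 [simp]: "smul (Suc 0) \<alpha> = \<alpha>"
  by (simp add: smul_def)

lemma smul_cancel: "c > 0 \<Longrightarrow> smul c \<alpha> = smul c \<beta> \<longleftrightarrow> \<alpha> = \<beta>"
  by (auto simp: smul_def prod_eq_iff)

lemma finite_tdeg_le [simp]: "finite {\<alpha>. m \<le> tdeg \<alpha> \<and> tdeg \<alpha> \<le> n}"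
  by (rule finite_subset [of _ "{..n} \<times> {..n}"]) (auto simp: tdeg_def)

lemma finite_tdeg_eq [simp]: "finite {\<alpha>. tdeg \<alpha> = n}"
  by (rule finite_subset [of _ "{..n} \<times> {..n}"]) (auto simp: tdeg_def)

text \<open>Both sides range over all \<open>c\<close>, \<open>d\<close>, \<open>a\<close>,
  \<open>b\<close> of total sum \<open>n\<close>, grouped as (c + d) + (a + b) and as (c + a) + (d +
  b). This yields the product rule for composites.\<close>

lemma sum_antidiag_interchange:
  fixes f :: "_ \<Rightarrow> _ \<Rightarrow> _ \<Rightarrow> _ \<Rightarrow> 'a::comm_monoid_add"
  shows "(\<Sum>(i, j)\<in>antidiag n. \<Sum>(a, b)\<in>antidiag j. \<Sum>(c, d)\<in>antidiag i. f c d a b)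
    = (\<Sum>(u, v)\<in>antidiag n. \<Sum>(c, a)\<in>antidiag u. \<Sum>(d, b)\<in>antidiag v. f c d a b)"
proof -
  have "(\<Sum>(i, j)\<in>antidiag n. \<Sum>(a, b)\<in>antidiag j. \<Sum>(c, d)\<in>antidiag i. f c d a b)
    = (\<Sum>((i, j), (a, b), (c, d))\<in>Sigma (antidiag n) (\<lambda>(i, j). antidiag j \<times> antidiag i). f c d a b)"
    by (subst sum.Sigma [symmetric])
      (auto intro!: sum.cong simp: sum.cartesian_product split_def)
  also have "\<dots> = (\<Sum>((u, v), (c, a), (d, b))\<in>Sigma (antidiag n) (\<lambda>(u, v). antidiag u \<times> antidiag v). f c d a b)"
    by (rule sum.reindex_bij_witness [where
        i = "\<lambda>((u, v), (c, a), (d, b)). ((c + d, a + b), (a, b), (c, d))" and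
        j = "\<lambda>((i, j), (a, b), (c, d)). ((c + a, d + b), (c, a), (d, b))"])
      (auto simp: add_ac)
  also have "\<dots> = (\<Sum>(u, v)\<in>antidiag n. \<Sum>(c, a)\<in>antidiag u. \<Sum>(d, b)\<in>antidiag v. f c d a b)"
    by (subst sum.Sigma [symmetric])
      (auto intro!: sum.cong simp: sum.cartesian_product split_def)
  finally show ?thesis .
qed

lemma sum_antidiag_ends:
  assumes "n \<noteq> 0"
  shows "(\<Sum>(i, j)\<in>antidiag n. f i j) = f 0 n + f n 0 +
    (\<Sum>(i, j)\<in>antidiag n - {(0, n), (n, 0)}. f i j :: 'a::comm_monoid_add)"
proof -
  have "(\<Sum>(i, j)\<in>antidiag n. f i j) = (\<Sum>(i, j)\<in>{(0, n), (n, 0)}. f i j) +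
      (\<Sum>(i, j)\<in>antidiag n - {(0, n), (n, 0)}. f i j)"
    by (rule sum.subset_diff [THEN trans]) (auto simp: add.commute)
  then show ?thesis
    using assms by simp
qed

text \<open>Brings every mixed term of a product or composite under the hypotheses about degrees
  below that of \<open>n\<close>.\<close>

lemma antidiag_interior_cases:
  assumes "ij \<in> antidiag n - {(0, n), (n, 0)}"
  obtains i j where "ij = (i, j)" "0 < tdeg i" "0 < tdeg j" "tdeg i < tdeg n" "tdeg j < tdeg n"
proof -
  obtain i j where ij: "ij = (i, j)"
    by (cases ij)
  then have n: "n = i + j" and "i \<noteq> 0" "j \<noteq> 0"
    using assms by auto
  then have "0 < tdeg i" "0 < tdeg j"
    by (auto simp flip: neq0_conv)
  then show thesis
    using ij n by (intro that [of i j]) (simp_all add: tdeg_add)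
qed

section \<open>Two-variable derivations, their composition, and substitution into one-variable
  ones\<close>

definition HS2 :: "('k::comm_ring_1 \<Rightarrow> 'a::comm_ring_1 \<Rightarrow> 'a) \<Rightarrow> (nat \<times> nat \<Rightarrow> 'a \<Rightarrow> 'a) set" where
  "HS2 s = {D. D 0 = id \<and> (\<forall>i. module_hom s s (D i)) \<and>
     (\<forall>n x y. D n (x * y) = (\<Sum>(i, j)\<in>antidiag n. D i x * D j y))}"

definition ident2 :: "nat \<times> nat \<Rightarrow> 'a \<Rightarrow> 'a::comm_ring_1" where
  "ident2 n = (if n = 0 then id else (\<lambda>_. 0))"

definition comp2 :: "(nat \<times> nat \<Rightarrow> 'a \<Rightarrow> 'a) \<Rightarrow> (nat \<times> nat \<Rightarrow> 'a \<Rightarrow> 'a) \<Rightarrow> nat \<times> nat \<Rightarrow> 'a \<Rightarrow> 'a::comm_ring_1"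
  where "comp2 D E n x = (\<Sum>(i, j)\<in>antidiag n. D i (E j x))"

(* E(t^\<alpha>) for the series E(t); without the guard, truncated division gives junk off the multiples of \<alpha>. *)
definition subst_monom :: "nat \<times> nat \<Rightarrow> (nat \<Rightarrow> 'a \<Rightarrow> 'a) \<Rightarrow> nat \<times> nat \<Rightarrow> 'a \<Rightarrow> 'a::comm_ring_1" where
  "subst_monom \<alpha> E n =
    (if n = smul (tdeg n div tdeg \<alpha>) \<alpha> then E (tdeg n div tdeg \<alpha>) else (\<lambda>_. 0))"

(* E(u + v) for the series E(t). *)
definition subst_sum :: "(nat \<Rightarrow> 'a \<Rightarrow> 'a) \<Rightarrow> nat \<times> nat \<Rightarrow> 'a \<Rightarrow> 'a::comm_ring_1" where
  "subst_sum E n x = of_nat (tdeg n choose fst n) * E (tdeg n) x"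

lemma HS2_0: "D \<in> HS2 s \<Longrightarrow> D 0 = id"
  and HS2_hom: "D \<in> HS2 s \<Longrightarrow> module_hom s s (D n)"
  and HS2_mult: "D \<in> HS2 s \<Longrightarrow> D n (x * y) = (\<Sum>(i, j)\<in>antidiag n. D i x * D j y)"
  unfolding HS2_def by blast+

lemma HS_inf_0: "E \<in> HS_inf s \<Longrightarrow> E 0 = id"
  and HS_inf_hom: "E \<in> HS_inf s \<Longrightarrow> module_hom s s (E i)"
  and HS_inf_mult: "E \<in> HS_inf s \<Longrightarrow> E i (x * y) = (\<Sum>j\<le>i. E j x * E (i - j) y)"
  by (auto simp: HS_inf_def)

lemma HS2_add: "D \<in> HS2 s \<Longrightarrow> D n (x + y) = D n x + D n y"
  and HS2_zero: "D \<in> HS2 s \<Longrightarrow> D n 0 = 0"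
  and HS2_sum: "D \<in> HS2 s \<Longrightarrow> D n (\<Sum>i\<in>S. f i) = (\<Sum>i\<in>S. D n (f i))"
  and HS2_scale: "D \<in> HS2 s \<Longrightarrow> D n (s c x) = s c (D n x)"
  using module_hom.add module_hom.zero module_hom.sum module_hom.scale HS2_hom by metis+

lemma subst_monom_smul: "tdeg \<alpha> > 0 \<Longrightarrow> subst_monom \<alpha> E (smul c \<alpha>) = E c"
  by (simp add: subst_monom_def)

lemma subst_monom_eq_0: "(\<And>c. n \<noteq> smul c \<alpha>) \<Longrightarrow> subst_monom \<alpha> E n = (\<lambda>_. 0)"
  by (simp add: subst_monom_def)

text \<open>Along the ray of multiples of \<open>\<alpha>\<close> a two-variable sum collapses to a
  one-variable one. This serves substitution of monomials and, for (1, 0), restriction to an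
  axis.\<close>

lemma sum_antidiag_smul:
  assumes "tdeg \<alpha> > 0"
    and "\<And>i j. i + j = smul c \<alpha> \<Longrightarrow> (\<And>a b. i = smul a \<alpha> \<Longrightarrow> j = smul b \<alpha> \<Longrightarrow> False) \<Longrightarrow> f i j = 0"
  shows "(\<Sum>(i, j)\<in>antidiag (smul c \<alpha>). f i j) =
    (\<Sum>a\<le>c. f (smul a \<alpha>) (smul (c - a) \<alpha>) :: 'a::comm_monoid_add)"
proof -
  have inj: "smul a \<alpha> = smul b \<alpha> \<longleftrightarrow> a = b" for a b
    using assms(1) by (metis tdeg_smul mult_cancel2 neq0_conv)
  have "(\<Sum>(i, j)\<in>antidiag (smul c \<alpha>). f i j) =
      (\<Sum>(i, j)\<in>(\<lambda>a. (smul a \<alpha>, smul (c - a) \<alpha>)) ` {..c}. f i j)"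
  proof (rule sum.mono_neutral_right)
    show "(\<lambda>a. (smul a \<alpha>, smul (c - a) \<alpha>)) ` {..c} \<subseteq> antidiag (smul c \<alpha>)"
      by (auto simp flip: smul_add)
    show "\<forall>q\<in>antidiag (smul c \<alpha>) - (\<lambda>a. (smul a \<alpha>, smul (c - a) \<alpha>)) ` {..c}.
        (case q of (i, j) \<Rightarrow> f i j) = 0"
    proof safe
      fix i1 i2 j1 j2
      assume ad: "((i1, i2), (j1, j2)) \<in> antidiag (smul c \<alpha>)"
        and n: "((i1, i2), (j1, j2)) \<notin> (\<lambda>a. (smul a \<alpha>, smul (c - a) \<alpha>)) ` {..c}"
      show "f (i1, i2) (j1, j2) = 0"
      proof (rule assms(2))
        show "(i1, i2) + (j1, j2) = smul c \<alpha>"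
          using ad by simp
        fix a b
        assume a: "(i1, i2) = smul a \<alpha>" "(j1, j2) = smul b \<alpha>"
        then have "c = a + b"
          using ad inj by (simp flip: smul_add)
        then show False
          using n a by (auto simp: image_iff)
      qed
    qed
  qed simp
  also have "\<dots> = (\<Sum>a\<le>c. f (smul a \<alpha>) (smul (c - a) \<alpha>))"
    by (subst sum.reindex) (auto simp: inj_on_def inj)
  finally show ?thesis .
qed

context
  fixes s :: "'k::comm_ring_1 \<Rightarrow> 'a::comm_ring_1 \<Rightarrow> 'a"
  assumes module: "module s"
begin

interpretation module s
  by (rule module)

lemma module_hom_zero': "module_hom s s (\<lambda>_. 0)"
  by (simp add: module_hom_iff module)

lemma ident2_HS2: "ident2 \<in> HS2 s"
proof -
  have "ident2 n (x * y) = (\<Sum>(i, j)\<in>antidiag n. ident2 i x * ident2 j y)" for n and x y :: 'a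
  proof (cases "n = 0")
    case True
    have "antidiag 0 = {(0, 0)}"
      by (auto simp: antidiag_def prod_eq_iff)
    then show ?thesis
      by (simp add: True ident2_def)
  next
    case False
    have "ident2 i x * ident2 j y = 0" if "i + j = n" for i j
      using False that by (cases "i = 0") (simp_all add: ident2_def)
    then have "(\<Sum>(i, j)\<in>antidiag n. ident2 i x * ident2 j y) = 0"
      by (intro sum.neutral) auto
    then show ?thesis
      using False by (simp add: ident2_def)
  qed
  then show ?thesis
    by (simp add: HS2_def) (simp add: ident2_def module_hom_zero' module_hom_id)
qed

lemma comp2_HS2:
  assumes D: "D \<in> HS2 s" and E: "E \<in> HS2 s"
  shows "comp2 D E \<in> HS2 s"
proof -
  have "comp2 D E 0 = id"
  proof -
    have "antidiag 0 = {(0, 0)}"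
      by (auto simp: antidiag_def prod_eq_iff)
    then show ?thesis
      by (simp add: comp2_def fun_eq_iff HS2_0 [OF D] HS2_0 [OF E])
  qed
  moreover have "module_hom s s (comp2 D E n)" for n
    by (simp add: module_hom_iff module comp2_def HS2_add [OF D] HS2_add [OF E] HS2_scale [OF D]
        HS2_scale [OF E] scale_sum_right split_def sum.distrib)
  moreover have "comp2 D E n (x * y) = (\<Sum>(u, v)\<in>antidiag n. comp2 D E u x * comp2 D E v y)" for n x y
  proof -
    have "comp2 D E n (x * y) = (\<Sum>(i, j)\<in>antidiag n. \<Sum>(a, b)\<in>antidiag j. \<Sum>(c, d)\<in>antidiag i.
        D c (E a x) * D d (E b y))"
      by (simp add: comp2_def HS2_mult [OF D] HS2_mult [OF E] HS2_sum [OF D] split_def)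
    also have "\<dots> = (\<Sum>(u, v)\<in>antidiag n. \<Sum>(c, a)\<in>antidiag u. \<Sum>(d, b)\<in>antidiag v.
        D c (E a x) * D d (E b y))"
      by (rule sum_antidiag_interchange)
    also have "\<dots> = (\<Sum>(u, v)\<in>antidiag n. comp2 D E u x * comp2 D E v y)"
      by (simp add: comp2_def sum_product split_def)
    finally show ?thesis .
  qed
  ultimately show ?thesis
    by (simp add: HS2_def)
qed

lemma subst_monom_HS2:
  assumes E: "E \<in> HS_inf s" and \<alpha>: "tdeg \<alpha> > 0"
  shows "subst_monom \<alpha> E \<in> HS2 s"
proof -
  have "subst_monom \<alpha> E n (x * y) = (\<Sum>(i, j)\<in>antidiag n. subst_monom \<alpha> E i x * subst_monom \<alpha> E j y)"
    for n x y
  proof (cases "\<exists>c. n = smul c \<alpha>")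
    case True
    then obtain c where c: "n = smul c \<alpha>" ..
    have "(\<Sum>(i, j)\<in>antidiag n. subst_monom \<alpha> E i x * subst_monom \<alpha> E j y) =
        (\<Sum>a\<le>c. subst_monom \<alpha> E (smul a \<alpha>) x * subst_monom \<alpha> E (smul (c - a) \<alpha>) y)"
      unfolding c
    proof (rule sum_antidiag_smul [OF \<alpha>])
      fix i j
      assume "\<And>a b. i = smul a \<alpha> \<Longrightarrow> j = smul b \<alpha> \<Longrightarrow> False"
      then have "(\<forall>a. i \<noteq> smul a \<alpha>) \<or> (\<forall>b. j \<noteq> smul b \<alpha>)"
        by blast
      then show "subst_monom \<alpha> E i x * subst_monom \<alpha> E j y = 0"
        by (auto simp: subst_monom_eq_0)
    qed
    then show ?thesis
      by (simp add: c subst_monom_smul [OF \<alpha>] HS_inf_mult [OF E])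
  next
    case False
    have "subst_monom \<alpha> E i x * subst_monom \<alpha> E j y = 0" if "i + j = n" for i j
    proof -
      have "(\<forall>a. i \<noteq> smul a \<alpha>) \<or> (\<forall>b. j \<noteq> smul b \<alpha>)"
        using False that smul_add by metis
      then show ?thesis
        by (auto simp: subst_monom_eq_0)
    qed
    then have "(\<Sum>(i, j)\<in>antidiag n. subst_monom \<alpha> E i x * subst_monom \<alpha> E j y) = 0"
      by (intro sum.neutral) auto
    then show ?thesis
      using False by (simp add: subst_monom_eq_0)
  qed
  then show ?thesis
    by (simp add: HS2_def)
      (simp add: subst_monom_def HS_inf_0 [OF E] HS_inf_hom [OF E] module_hom_zero')
qed

text \<open>The product rule is Vandermonde's identity: for a fixed degree i of the first factor,
  the products of binomial coefficients add up to \<open>(a + b) choose a\<close>.\<close>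

lemma subst_sum_HS2:
  assumes E: "E \<in> HS_inf s"
  shows "subst_sum E \<in> HS2 s"
proof -
  have "subst_sum E 0 = id"
    by (simp add: subst_sum_def HS_inf_0 [OF E] fun_eq_iff)
  moreover have "module_hom s s (subst_sum E n)" for n
  proof -
    have "s c (of_nat k * x) = of_nat k * s c x" for c k and x :: 'a
      by (induction k) (simp_all add: distrib_right scale_right_distrib)
    then show ?thesis
      using HS_inf_hom [OF E] by (simp add: module_hom_iff subst_sum_def distrib_left)
  qed
  moreover have "subst_sum E n (x * y) = (\<Sum>(u, v)\<in>antidiag n. subst_sum E u x * subst_sum E v y)"
    for n x y
  proof -
    define a b where "a = fst n" and "b = snd n"
    have n: "n = (a, b)" by (simp add: a_def b_def)
    let ?g = "\<lambda>i k. of_nat ((i choose k) * ((a + b - i) choose (a - k))) * (E i x * E (a + b - i) y)"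
    have "(\<Sum>(u, v)\<in>antidiag n. subst_sum E u x * subst_sum E v y) =
        (\<Sum>(u, v)\<in>antidiag n. ?g (tdeg u) (fst u))"
      by (intro sum.cong) (auto simp: n subst_sum_def tdeg_def add_ac mult_ac)
    \<comment> \<open>A decomposition of (a, b) is determined by the total degree and the first
      coordinate \<open>k\<close> of its first part; the bounds on \<open>k\<close> keep all four
      coordinates nonnegative.\<close>
    also have "\<dots> = (\<Sum>(u, k)\<in>Sigma {..a + b} (\<lambda>i. {k. k \<le> i \<and> k \<le> a \<and> i \<le> k + b}). ?g u k)"
      by (rule sum.reindex_bij_witness [where
          i = "\<lambda>(i, k). ((k, i - k), (a - k, b - (i - k)))" and
          j = "\<lambda>(u, v). (tdeg u, fst u)"])
        (auto simp: n tdeg_def)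
    also have "\<dots> = (\<Sum>i\<le>a + b. \<Sum>k | k \<le> i \<and> k \<le> a \<and> i \<le> k + b. ?g i k)"
      by (subst sum.Sigma) auto
    \<comment> \<open>For \<open>k\<close> outside the bounds one of the two binomial coefficients
      vanishes.\<close>
    also have "\<dots> = (\<Sum>i\<le>a + b. \<Sum>k\<le>a. ?g i k)"
    proof (rule sum.cong [OF refl], rule sum.mono_neutral_left, simp, force, rule ballI)
      fix i k
      assume i: "i \<in> {..a + b}" and k: "k \<in> {..a} - {k. k \<le> i \<and> k \<le> a \<and> i \<le> k + b}"
      then have "i < k \<or> a + b - i < a - k"
        by auto
      then have "(i choose k) * ((a + b - i) choose (a - k)) = 0"
        by auto
      then show "?g i k = 0"
        by (simp only: of_nat_0 mult_zero_left)
    qed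
    also have "\<dots> = (\<Sum>i\<le>a + b. of_nat ((a + b) choose a) * (E i x * E (a + b - i) y))"
    proof (intro sum.cong refl)
      fix i
      assume "i \<in> {..a + b}"
      then have "(\<Sum>k\<le>a. (i choose k) * ((a + b - i) choose (a - k))) = (a + b) choose a"
        by (simp add: vandermonde)
      then show "(\<Sum>k\<le>a. ?g i k) = of_nat ((a + b) choose a) * (E i x * E (a + b - i) y)"
        by (simp only: sum_distrib_right [symmetric] of_nat_sum [symmetric])
    qed
    also have "\<dots> = subst_sum E n (x * y)"
      by (simp add: subst_sum_def n tdeg_def HS_inf_mult [OF E] sum_distrib_left)
    finally show ?thesis ..
  qed
  ultimately show ?thesis
    by (simp add: HS2_def)
qed

text \<open>This sets v = 0: an exponent on the axis decomposes only into exponents on the axis.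
  One-variable composites are thus obtained by composing in two variables and restricting.\<close>

lemma HS2_axis:
  assumes D: "D \<in> HS2 s"
  shows "(\<lambda>i. D (i, 0)) \<in> HS_inf s"
proof -
  have "D (n, 0) (x * y) = (\<Sum>i\<le>n. D (i, 0) x * D (n - i, 0) y)" for n x y
  proof -
    have "(\<Sum>(i, j)\<in>antidiag (smul n (1, 0)). D i x * D j y) =
        (\<Sum>a\<le>n. D (smul a (1, 0)) x * D (smul (n - a) (1, 0)) y)"
    proof (rule sum_antidiag_smul)
      fix i j :: "nat \<times> nat"
      assume *: "i + j = smul n (1, 0)" "\<And>a b. i = smul a (1, 0) \<Longrightarrow> j = smul b (1, 0) \<Longrightarrow> False"
      show "D i x * D j y = 0"
        using * by (cases i; cases j) (auto simp: smul_def)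
    qed (simp add: tdeg_def)
    then show ?thesis
      by (simp add: HS2_mult [OF D] smul_def)
  qed
  moreover have "D (0, 0) = id"
    using HS2_0 [OF D] by (simp add: zero_prod_def)
  ultimately show ?thesis
    by (simp add: HS_inf_def HS2_hom [OF D])
qed

end

lemma subst_monom_axis:
  assumes "k > 0"
  shows "subst_monom (k, 0) E (i, 0) = (if k dvd i then E (i div k) else (\<lambda>_. 0))"
proof (cases "k dvd i")
  case True
  then obtain q where "i = k * q" ..
  then show ?thesis
    using assms subst_monom_smul [of "(k, 0)" E q] by (simp add: mult.commute)
next
  case False
  then show ?thesis
    by (auto intro!: subst_monom_eq_0)
qed

lemma comp2_axis: "comp2 D E (n, 0) x = (\<Sum>i\<le>n. D (i, 0) (E (n - i, 0) x))"
proof -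
  have "(\<Sum>(i, j)\<in>antidiag (smul n (1, 0)). D i (E j x)) =
      (\<Sum>a\<le>n. D (smul a (1, 0)) (E (smul (n - a) (1, 0)) x))"
  proof (rule sum_antidiag_smul)
    fix i j :: "nat \<times> nat"
    assume *: "i + j = smul n (1, 0)" "\<And>a b. i = smul a (1, 0) \<Longrightarrow> j = smul b (1, 0) \<Longrightarrow> False"
    show "D i (E j x) = 0"
      using * by (cases i; cases j) auto
  qed simp
  then show ?thesis
    by (simp add: comp2_def)
qed

section \<open>Obstructions and integrability of leading terms\<close>

text \<open>Keeps quantified exponents whole, so that facts stated with \<open>tdeg\<close> and
  \<open>smul\<close> continue to apply to them.\<close>

declare split_paired_All [simp del] split_paired_Ex [simp del]

text \<open>\<open>derivation_integrable\<close> is the property of polynomial rings on which the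
  argument rests: every derivation has an integral of infinite length, with no regard to the
  ideal.\<close>

locale hs_ideal =
  fixes s :: "'k::comm_ring_1 \<Rightarrow> 'a::comm_ring_1 \<Rightarrow> 'a" and I :: "'a set" and p :: nat
  assumes module: "module s"
    and ideal: "is_ideal I"
    and prime: "prime p"
    and char: "of_nat p = (0 :: 'a)"
    and derivation_integrable: "\<And>\<delta>. module_hom s s \<delta> \<Longrightarrow> (\<And>x y. \<delta> (x * y) = x * \<delta> y + \<delta> x * y) \<Longrightarrow>
      \<exists>E\<in>HS_inf s. E 1 = \<delta>"
begin

definition log_below :: "nat \<Rightarrow> (nat \<times> nat \<Rightarrow> 'a \<Rightarrow> 'a) \<Rightarrow> bool" where
  "log_below N D \<longleftrightarrow> (\<forall>\<beta>. tdeg \<beta> < N \<longrightarrow> (\<forall>x\<in>I. D \<beta> x \<in> I))"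

(* The condition says that E(t^\<alpha>) is logarithmic below total degree N when \<alpha> has total degree n. *)
definition HS_inf_log :: "nat \<Rightarrow> nat \<Rightarrow> (nat \<Rightarrow> 'a \<Rightarrow> 'a) set" where
  "HS_inf_log N n = {E \<in> HS_inf s. \<forall>c. c * n < N \<longrightarrow> (\<forall>x\<in>I. E c x \<in> I)}"

lemma ideal_zero: "0 \<in> I"
  and ideal_add: "x \<in> I \<Longrightarrow> y \<in> I \<Longrightarrow> x + y \<in> I"
  and ideal_mult: "x \<in> I \<Longrightarrow> c * x \<in> I"
  using ideal by (auto simp: is_ideal_iff)

lemma ideal_uminus: "x \<in> I \<Longrightarrow> - x \<in> I"
  using ideal_mult [of x "- 1"] by simp

lemma ideal_diff: "x \<in> I \<Longrightarrow> y \<in> I \<Longrightarrow> x - y \<in> I"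
  using ideal_add [of x "- y"] ideal_uminus [of y] by simp

lemma ideal_sum: "(\<And>i. i \<in> S \<Longrightarrow> f i \<in> I) \<Longrightarrow> (\<Sum>i\<in>S. f i) \<in> I"
  by (induction S rule: infinite_finite_induct) (auto intro: ideal_zero ideal_add)

lemma ideal_diff_trans: "x - y \<in> I \<Longrightarrow> y - z \<in> I \<Longrightarrow> x - z \<in> I"
  using ideal_add [of "x - y" "y - z"] by simp

lemma ideal_diff_iff: "x - y \<in> I \<Longrightarrow> x \<in> I \<longleftrightarrow> y \<in> I"
  using ideal_add [of "x - y" y] ideal_diff [of x "x - y"] by auto

section \<open>Composition: additivity of obstructions and of leading terms\<close>

lemma comp2_log_below:
  assumes "log_below N D" "log_below N E"
  shows "log_below N (comp2 D E)"
  unfolding log_below_def comp2_def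
proof (intro allI impI ballI ideal_sum)
  fix \<beta> x ij
  assume \<beta>: "tdeg \<beta> < N" "x \<in> I" and "ij \<in> antidiag \<beta>"
  then obtain i j where ij: "ij = (i, j)" "\<beta> = i + j"
    by (cases ij) auto
  then have "tdeg i < N" "tdeg j < N"
    using \<beta> by (simp_all add: tdeg_add)
  then show "(case ij of (i, j) \<Rightarrow> D i (E j x)) \<in> I"
    using assms ij \<beta> by (simp add: log_below_def)
qed

text \<open>In degree \<open>N\<close> a mixed term \<open>D i (E j x)\<close> has both degrees
  below \<open>N\<close> and so stays in \<open>I\<close>; modulo \<open>I\<close> only the terms
  with \<open>i = 0\<close> or \<open>j = 0\<close> remain. Hence obstructions add up.\<close>

lemma comp2_top:
  assumes "D \<in> HS2 s" "E \<in> HS2 s" "log_below N D" "log_below N E" "N \<ge> 1" "tdeg \<beta> = N" "x \<in> I"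
  shows "comp2 D E \<beta> x - (D \<beta> x + E \<beta> x) \<in> I"
proof -
  have "\<beta> \<noteq> 0"
    using assms by auto
  have "(\<Sum>(i, j)\<in>antidiag \<beta> - {(0, \<beta>), (\<beta>, 0)}. D i (E j x)) \<in> I"
  proof (rule ideal_sum)
    fix ij
    assume "ij \<in> antidiag \<beta> - {(0, \<beta>), (\<beta>, 0)}"
    then show "(case ij of (i, j) \<Rightarrow> D i (E j x)) \<in> I"
      by (cases rule: antidiag_interior_cases) (use assms in \<open>simp add: log_below_def\<close>)
  qed
  then show ?thesis
    using assms HS2_0 [of D s] HS2_0 [of E s]
    by (simp add: comp2_def sum_antidiag_ends [OF \<open>\<beta> \<noteq> 0\<close>])
qed

text \<open>Here equality is exact, not modulo \<open>I\<close>: degree \<open>n\<close> is the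
  earliest in which composing with \<open>E\<close> can change \<open>D\<close>, and there it adds
  the coefficient of \<open>E\<close>.\<close>

lemma comp2_low:
  assumes D: "D \<in> HS2 s" and E: "E \<in> HS2 s" and "n \<ge> 1"
    and van: "\<And>\<beta>. 0 < tdeg \<beta> \<Longrightarrow> tdeg \<beta> < n \<Longrightarrow> E \<beta> = (\<lambda>_. 0)" and "tdeg \<beta> \<le> n"
  shows "comp2 D E \<beta> x = D \<beta> x + (if tdeg \<beta> = n then E \<beta> x else 0)"
proof (cases "\<beta> = 0")
  case True
  then show ?thesis
    using HS2_0 [OF comp2_HS2 [OF module D E]] HS2_0 [OF D] \<open>n \<ge> 1\<close> by simp
next
  case False
  have "(\<Sum>(i, j)\<in>antidiag \<beta> - {(0, \<beta>), (\<beta>, 0)}. D i (E j x)) = 0"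
  proof (rule sum.neutral, rule ballI)
    fix ij
    assume "ij \<in> antidiag \<beta> - {(0, \<beta>), (\<beta>, 0)}"
    then show "(case ij of (i, j) \<Rightarrow> D i (E j x)) = 0"
      by (cases rule: antidiag_interior_cases)
        (use van \<open>tdeg \<beta> \<le> n\<close> in \<open>simp add: HS2_zero [OF D]\<close>)
  qed
  moreover have "tdeg \<beta> > 0"
    using False by (simp flip: neq0_conv)
  ultimately show ?thesis
    using van [of \<beta>] \<open>tdeg \<beta> \<le> n\<close> HS2_0 [OF D] HS2_0 [OF E]
    by (cases "tdeg \<beta> = n") (simp_all add: comp2_def sum_antidiag_ends [OF False])
qed

text \<open>Iterates the two additivity facts. Only sums of coefficients are recorded, so no order
  of the factors has to be fixed; degree \<open>n\<close> controls leading terms and degree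
  \<open>N\<close> obstructions.\<close>

lemma HS2_prod_exists:
  assumes "finite S" "P \<in> HS2 s" "log_below N P" and N: "N \<ge> 1" and n: "n \<ge> 1"
    and "\<And>i. i \<in> S \<Longrightarrow> F i \<in> HS2 s" "\<And>i. i \<in> S \<Longrightarrow> log_below N (F i)"
    and "\<And>i \<beta>. i \<in> S \<Longrightarrow> 0 < tdeg \<beta> \<Longrightarrow> tdeg \<beta> < n \<Longrightarrow> F i \<beta> = (\<lambda>_. 0)"
  shows "\<exists>Q\<in>HS2 s. log_below N Q \<and> (\<forall>\<beta>. tdeg \<beta> < n \<longrightarrow> Q \<beta> = P \<beta>) \<and>
    (\<forall>\<beta> x. tdeg \<beta> = n \<longrightarrow> Q \<beta> x = P \<beta> x + (\<Sum>i\<in>S. F i \<beta> x)) \<and>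
    (\<forall>\<beta> x. tdeg \<beta> = N \<longrightarrow> x \<in> I \<longrightarrow> Q \<beta> x - (P \<beta> x + (\<Sum>i\<in>S. F i \<beta> x)) \<in> I)"
  using assms(1,6-)
proof (induction S)
  case empty
  then show ?case
    using assms(2,3) by (intro bexI [of _ P]) (auto simp: ideal_zero)
next
  case (insert i S)
  then obtain Q where Q: "Q \<in> HS2 s" "log_below N Q" "\<And>\<beta>. tdeg \<beta> < n \<Longrightarrow> Q \<beta> = P \<beta>"
      "\<And>\<beta> x. tdeg \<beta> = n \<Longrightarrow> Q \<beta> x = P \<beta> x + (\<Sum>i\<in>S. F i \<beta> x)"
      "\<And>\<beta> x. tdeg \<beta> = N \<Longrightarrow> x \<in> I \<Longrightarrow> Q \<beta> x - (P \<beta> x + (\<Sum>i\<in>S. F i \<beta> x)) \<in> I"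
    using insert.IH [OF insert.prems [OF insertI2]] by blast
  have Fi: "F i \<in> HS2 s" "log_below N (F i)"
      "\<And>\<beta>. 0 < tdeg \<beta> \<Longrightarrow> tdeg \<beta> < n \<Longrightarrow> F i \<beta> = (\<lambda>_. 0)"
    using insert.prems by blast+
  note low = comp2_low [OF Q(1) Fi(1) n Fi(3)]
  show ?case
  proof (intro bexI [of _ "comp2 Q (F i)"] conjI allI impI)
    show "comp2 Q (F i) \<in> HS2 s"
      by (rule comp2_HS2 [OF module Q(1) Fi(1)])
    show "log_below N (comp2 Q (F i))"
      by (rule comp2_log_below [OF Q(2) Fi(2)])
    show "comp2 Q (F i) \<beta> = P \<beta>" if "tdeg \<beta> < n" for \<beta>
      using that low [of \<beta>] Q(3) [of \<beta>] by (auto simp: fun_eq_iff)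
    show "comp2 Q (F i) \<beta> x = P \<beta> x + (\<Sum>i\<in>insert i S. F i \<beta> x)" if "tdeg \<beta> = n" for \<beta> x
      using that low [of \<beta>] Q(4) [of \<beta>] insert.hyps by (simp add: add_ac)
    show "comp2 Q (F i) \<beta> x - (P \<beta> x + (\<Sum>i\<in>insert i S. F i \<beta> x)) \<in> I"
      if "tdeg \<beta> = N" "x \<in> I" for \<beta> x
    proof -
      have "(comp2 Q (F i) \<beta> x - (Q \<beta> x + F i \<beta> x)) +
          (Q \<beta> x - (P \<beta> x + (\<Sum>i\<in>S. F i \<beta> x))) \<in> I"
        using comp2_top [OF Q(1) Fi(1) Q(2) Fi(2) N] Q(5) that by (intro ideal_add) auto
      then show ?thesis
        using insert.hyps by (simp add: algebra_simps)
    qed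
  qed
qed

text \<open>Agreement below degree \<open>n\<close> makes the mixed terms in degree \<open>n\<close>
  equal, so the difference there obeys the Leibniz rule and \<open>derivation_integrable\<close>
  applies.\<close>

lemma HS2_diff_integrable:
  assumes D: "D \<in> HS2 s" and P: "P \<in> HS2 s" and n: "n \<ge> 1"
    and agree: "\<And>\<beta>. tdeg \<beta> < n \<Longrightarrow> D \<beta> = P \<beta>" and \<alpha>: "tdeg \<alpha> = n"
  shows "\<exists>E\<in>HS_inf s. E 1 = (\<lambda>x. D \<alpha> x - P \<alpha> x)"
proof (rule derivation_integrable)
  interpret module_pair s s
    by (simp add: module_pair_def module)
  show "module_hom s s (\<lambda>x. D \<alpha> x - P \<alpha> x)"
    by (intro module_hom_sub HS2_hom [OF D] HS2_hom [OF P])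
  have nz: "\<alpha> \<noteq> 0"
    using \<alpha> n by auto
  have "(\<Sum>(i, j)\<in>antidiag \<alpha> - {(0, \<alpha>), (\<alpha>, 0)}. D i x * D j y) =
      (\<Sum>(i, j)\<in>antidiag \<alpha> - {(0, \<alpha>), (\<alpha>, 0)}. P i x * P j y)" for x y
  proof (intro sum.cong refl)
    fix ij
    assume "ij \<in> antidiag \<alpha> - {(0, \<alpha>), (\<alpha>, 0)}"
    then show "(case ij of (i, j) \<Rightarrow> D i x * D j y) = (case ij of (i, j) \<Rightarrow> P i x * P j y)"
      by (cases rule: antidiag_interior_cases) (use agree \<alpha> in simp)
  qed
  then show "D \<alpha> (x * y) - P \<alpha> (x * y) = x * (D \<alpha> y - P \<alpha> y) + (D \<alpha> x - P \<alpha> x) * y" for x y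
    by (simp add: HS2_mult [OF D] HS2_mult [OF P] sum_antidiag_ends [OF nz] HS2_0 [OF D] HS2_0 [OF P]
        algebra_simps)
qed

section \<open>Substituted series as factors, and the factorization of a derivation\<close>

lemma subst_monom_log_below:
  assumes "E \<in> HS_inf_log N (tdeg \<alpha>)" "tdeg \<alpha> > 0"
  shows "log_below N (subst_monom \<alpha> E)"
  unfolding log_below_def
proof (intro allI impI ballI)
  fix \<beta> x
  assume "tdeg \<beta> < N" "x \<in> I"
  then show "subst_monom \<alpha> E \<beta> x \<in> I"
    using assms subst_monom_smul [OF assms(2), of E] subst_monom_eq_0 [of \<beta> \<alpha> E]
    by (cases "\<exists>c. \<beta> = smul c \<alpha>") (auto simp: HS_inf_log_def ideal_zero)
qed

lemma subst_monom_low: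
  assumes "0 < tdeg \<beta>" "tdeg \<beta> < tdeg \<alpha>"
  shows "subst_monom \<alpha> E \<beta> = (\<lambda>_. 0)"
  using assms by (intro subst_monom_eq_0) (auto simp flip: neq0_conv)

lemma subst_monom_same_deg:
  assumes "tdeg \<beta> = tdeg \<alpha>" "0 < tdeg \<alpha>"
  shows "subst_monom \<alpha> E \<beta> = (if \<alpha> = \<beta> then E 1 else (\<lambda>_. 0))"
proof -
  have "subst_monom \<alpha> E \<beta> = (\<lambda>_. 0)" if "\<alpha> \<noteq> \<beta>"
    using that assms by (intro subst_monom_eq_0) auto
  then show ?thesis
    using subst_monom_smul [OF assms(2), of E 1] by auto
qed

text \<open>The claim of the induction on \<open>N\<close>. \<open>P\<close> stands for the partial
  product already split off from \<open>D\<close>; membership of \<open>E\<close> in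
  \<open>HS_inf_log N (tdeg \<alpha>)\<close> allows \<open>subst_monom \<alpha> E\<close> to serve
  as the next factor.\<close>

definition leading_terms_integrable :: "nat \<Rightarrow> bool" where
  "leading_terms_integrable N \<longleftrightarrow> (\<forall>D\<in>HS2 s. \<forall>P\<in>HS2 s. \<forall>\<alpha>. log_below N D \<longrightarrow> log_below N P \<longrightarrow>
     (\<forall>\<beta>. tdeg \<beta> < tdeg \<alpha> \<longrightarrow> D \<beta> = P \<beta>) \<longrightarrow> \<alpha> \<noteq> 0 \<longrightarrow>
     (\<exists>E\<in>HS_inf_log N (tdeg \<alpha>). E 1 = (\<lambda>x. D \<alpha> x - P \<alpha> x)))"

text \<open>Successive approximation: composing \<open>P\<close> with one factor for each exponent
  of degree \<open>n\<close> makes it agree with \<open>D\<close> in degree \<open>n\<close> too.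
  Once \<open>n\<close> exceeds \<open>N\<close>, additivity gives the obstruction. The parameter
  \<open>good\<close> allows factors from a smaller class than
  \<open>HS_inf_log N n\<close>.\<close>

lemma HS2_factor:
  assumes good: "\<And>n. n \<ge> 1 \<Longrightarrow> good n \<subseteq> HS_inf_log N n"
    and sel: "\<And>D P \<alpha>. D \<in> HS2 s \<Longrightarrow> P \<in> HS2 s \<Longrightarrow> log_below N D \<Longrightarrow> log_below N P \<Longrightarrow>
      (\<And>\<beta>. tdeg \<beta> < tdeg \<alpha> \<Longrightarrow> D \<beta> = P \<beta>) \<Longrightarrow> \<alpha> \<noteq> 0 \<Longrightarrow>
      \<exists>E\<in>good (tdeg \<alpha>). E 1 = (\<lambda>x. D \<alpha> x - P \<alpha> x)"
    and D: "D \<in> HS2 s" "log_below N D" and N: "N \<ge> 1"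
    and P: "P \<in> HS2 s" "log_below N P" and n: "n \<ge> 1"
    and agree: "\<And>\<beta>. tdeg \<beta> < n \<Longrightarrow> D \<beta> = P \<beta>"
  shows "\<exists>E. (\<forall>\<alpha>. n \<le> tdeg \<alpha> \<longrightarrow> tdeg \<alpha> \<le> N \<longrightarrow> E \<alpha> \<in> good (tdeg \<alpha>)) \<and>
    (\<forall>\<alpha>. tdeg \<alpha> = n \<longrightarrow> n \<le> N \<longrightarrow> E \<alpha> 1 = (\<lambda>x. D \<alpha> x - P \<alpha> x)) \<and>
    (\<forall>\<beta> x. tdeg \<beta> = N \<longrightarrow> x \<in> I \<longrightarrow>
      D \<beta> x - (P \<beta> x + (\<Sum>\<alpha> | n \<le> tdeg \<alpha> \<and> tdeg \<alpha> \<le> N. subst_monom \<alpha> (E \<alpha>) \<beta> x)) \<in> I)"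
  using P n agree
proof (induction "Suc N - n" arbitrary: P n)
  case 0
  \<comment> \<open>Here \<open>n > N\<close>: no factor is left, and \<open>D\<close> and
    \<open>P\<close> already agree in degree \<open>N\<close>.\<close>
  have empty: "{\<alpha>. n \<le> tdeg \<alpha> \<and> tdeg \<alpha> \<le> N} = {}"
    using 0 by auto
  have "D \<beta> = P \<beta>" if "tdeg \<beta> = N" for \<beta>
    using 0 that by simp
  then show ?case
    unfolding empty using 0 by (intro exI) (simp add: ideal_zero)
next
  case (Suc k)
  let ?S = "{\<alpha>. tdeg \<alpha> = n}"
  have "\<exists>E. \<forall>\<alpha>. tdeg \<alpha> = n \<longrightarrow> E \<alpha> \<in> good n \<and> E \<alpha> 1 = (\<lambda>x. D \<alpha> x - P \<alpha> x)"
    using sel [OF D(1) Suc.prems(1) D(2) Suc.prems(2)] Suc.prems(3,4)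
    by (intro choice) (metis One_nat_def not_one_le_zero tdeg_zero)
  then obtain E0 where E0: "\<And>\<alpha>. tdeg \<alpha> = n \<Longrightarrow> E0 \<alpha> \<in> good n"
      "\<And>\<alpha>. tdeg \<alpha> = n \<Longrightarrow> E0 \<alpha> 1 = (\<lambda>x. D \<alpha> x - P \<alpha> x)"
    by blast
  have E0': "E0 \<alpha> \<in> HS_inf_log N n" "E0 \<alpha> \<in> HS_inf s" if "tdeg \<alpha> = n" for \<alpha>
    using E0(1) [OF that] good [OF Suc.prems(3)] by (auto simp: HS_inf_log_def)
  have "\<exists>Q\<in>HS2 s. log_below N Q \<and> (\<forall>\<beta>. tdeg \<beta> < n \<longrightarrow> Q \<beta> = P \<beta>) \<and>
    (\<forall>\<beta> x. tdeg \<beta> = n \<longrightarrow> Q \<beta> x = P \<beta> x + (\<Sum>\<alpha>\<in>?S. subst_monom \<alpha> (E0 \<alpha>) \<beta> x)) \<and>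
    (\<forall>\<beta> x. tdeg \<beta> = N \<longrightarrow> x \<in> I \<longrightarrow> Q \<beta> x - (P \<beta> x + (\<Sum>\<alpha>\<in>?S. subst_monom \<alpha> (E0 \<alpha>) \<beta> x)) \<in> I)"
    using Suc.prems E0' N
    by (intro HS2_prod_exists subst_monom_HS2 [OF module] subst_monom_log_below subst_monom_low) auto
  then obtain Q where Q: "Q \<in> HS2 s" "log_below N Q" "\<And>\<beta>. tdeg \<beta> < n \<Longrightarrow> Q \<beta> = P \<beta>"
      "\<And>\<beta> x. tdeg \<beta> = n \<Longrightarrow> Q \<beta> x = P \<beta> x + (\<Sum>\<alpha>\<in>?S. subst_monom \<alpha> (E0 \<alpha>) \<beta> x)"
      "\<And>\<beta> x. tdeg \<beta> = N \<Longrightarrow> x \<in> I \<Longrightarrow> Q \<beta> x - (P \<beta> x + (\<Sum>\<alpha>\<in>?S. subst_monom \<alpha> (E0 \<alpha>) \<beta> x)) \<in> I"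
    by blast
  \<comment> \<open>In degree \<open>n\<close> only the factor with exponent \<open>\<beta>\<close>
    itself contributes at \<open>\<beta>\<close>, namely the difference of \<open>D\<close> and
    \<open>P\<close> there.\<close>
  have QD: "D \<beta> = Q \<beta>" if "tdeg \<beta> < Suc n" for \<beta>
  proof (cases "tdeg \<beta> < n")
    case False
    then have \<beta>: "tdeg \<beta> = n"
      using that by simp
    have "(\<Sum>\<alpha>\<in>?S. subst_monom \<alpha> (E0 \<alpha>) \<beta> x) = (\<Sum>\<alpha>\<in>?S. if \<alpha> = \<beta> then E0 \<beta> 1 x else 0)" for x
      using \<beta> Suc.prems(3) by (intro sum.cong) (auto simp: subst_monom_same_deg)
    then have "(\<Sum>\<alpha>\<in>?S. subst_monom \<alpha> (E0 \<alpha>) \<beta> x) = D \<beta> x - P \<beta> x" for x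
      using \<beta> E0(2) by simp
    then show ?thesis
      using Q(4) [OF \<beta>] by (simp add: fun_eq_iff)
  qed (use Suc.prems Q in auto)
  have k: "k = Suc N - Suc n" and le: "1 \<le> Suc n"
    using Suc.hyps(2) by simp_all
  obtain E1 where E1: "\<And>\<alpha>. Suc n \<le> tdeg \<alpha> \<Longrightarrow> tdeg \<alpha> \<le> N \<Longrightarrow> E1 \<alpha> \<in> good (tdeg \<alpha>)"
    "\<And>\<beta> x. tdeg \<beta> = N \<Longrightarrow> x \<in> I \<Longrightarrow> D \<beta> x - (Q \<beta> x +
      (\<Sum>\<alpha> | Suc n \<le> tdeg \<alpha> \<and> tdeg \<alpha> \<le> N. subst_monom \<alpha> (E1 \<alpha>) \<beta> x)) \<in> I"
    using Suc.hyps(1) [OF k Q(1,2) le QD] by blast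
  define E where "E \<alpha> = (if tdeg \<alpha> = n then E0 \<alpha> else E1 \<alpha>)" for \<alpha>
  show ?case
  proof (intro exI [of _ E] conjI allI impI)
    show "E \<alpha> \<in> good (tdeg \<alpha>)" if "n \<le> tdeg \<alpha>" "tdeg \<alpha> \<le> N" for \<alpha>
      using that E0(1) E1(1) by (simp add: E_def)
    show "E \<alpha> 1 = (\<lambda>x. D \<alpha> x - P \<alpha> x)" if "tdeg \<alpha> = n" "n \<le> N" for \<alpha>
      using that E0(2) by (simp add: E_def)
    fix \<beta> x
    assume \<beta>: "tdeg \<beta> = N" and x: "x \<in> I"
    let ?T = "{\<alpha>. Suc n \<le> tdeg \<alpha> \<and> tdeg \<alpha> \<le> N}"
    have split: "{\<alpha>. n \<le> tdeg \<alpha> \<and> tdeg \<alpha> \<le> N} = ?S \<union> ?T"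
      using Suc.hyps(2) by auto
    have "(\<Sum>\<alpha> | n \<le> tdeg \<alpha> \<and> tdeg \<alpha> \<le> N. subst_monom \<alpha> (E \<alpha>) \<beta> x) =
        (\<Sum>\<alpha>\<in>?S. subst_monom \<alpha> (E \<alpha>) \<beta> x) + (\<Sum>\<alpha>\<in>?T. subst_monom \<alpha> (E \<alpha>) \<beta> x)"
      unfolding split by (rule sum.union_disjoint) auto
    also have "(\<Sum>\<alpha>\<in>?S. subst_monom \<alpha> (E \<alpha>) \<beta> x) = (\<Sum>\<alpha>\<in>?S. subst_monom \<alpha> (E0 \<alpha>) \<beta> x)"
      by (simp add: E_def)
    also have "(\<Sum>\<alpha>\<in>?T. subst_monom \<alpha> (E \<alpha>) \<beta> x) = (\<Sum>\<alpha>\<in>?T. subst_monom \<alpha> (E1 \<alpha>) \<beta> x)"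
      by (intro sum.cong) (auto simp: E_def)
    finally show "D \<beta> x - (P \<beta> x +
        (\<Sum>\<alpha> | n \<le> tdeg \<alpha> \<and> tdeg \<alpha> \<le> N. subst_monom \<alpha> (E \<alpha>) \<beta> x)) \<in> I"
      using ideal_add [OF E1(2) [OF \<beta> x] Q(5) [OF \<beta> x]] by (simp add: algebra_simps)
  qed
qed

text \<open>A factor contributes at \<open>\<beta>\<close> only if \<open>\<beta>\<close> is a
  multiple \<open>smul c \<alpha>\<close> of its exponent. For c = p^f with f \<le> e, cancellation
  forces \<alpha> = p^(e - f) \<alpha>0, which gives the displayed sum; \<open>rest\<close> puts all
  other contributions in \<open>I\<close>.\<close>

lemma sum_subst_monom_ppower:
  assumes \<beta>: "\<beta> = smul (p ^ e) \<alpha>0" and n0: "1 \<le> n0" "n0 \<le> tdeg \<alpha>0" and N: "tdeg \<beta> = N"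
    and rest: "\<And>\<alpha> c. smul c \<alpha> = \<beta> \<Longrightarrow> n0 \<le> tdeg \<alpha> \<Longrightarrow> (\<exists>f\<le>e. c = p ^ f) \<or> E \<alpha> c x \<in> I"
  shows "(\<Sum>\<alpha> | n0 \<le> tdeg \<alpha> \<and> tdeg \<alpha> \<le> N. subst_monom \<alpha> (E \<alpha>) \<beta> x) -
    (\<Sum>j\<le>e. E (smul (p ^ j) \<alpha>0) (p ^ (e - j)) x) \<in> I"
proof -
  let ?S = "{\<alpha>. n0 \<le> tdeg \<alpha> \<and> tdeg \<alpha> \<le> N}"
  let ?T = "(\<lambda>j. smul (p ^ j) \<alpha>0) ` {..e}"
  have p: "p > 1"
    using prime by (rule prime_gt_1_nat)
  have ppos: "p ^ j > 0" for j
    using p by simp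
  have pow: "p ^ (e - j) * p ^ j = p ^ e" if "j \<le> e" for j
    using that by (simp flip: power_add)
  have "?T \<subseteq> ?S"
  proof (rule image_subsetI)
    fix j assume j: "j \<in> {..e}"
    have "1 * n0 \<le> p ^ j * tdeg \<alpha>0"
      by (rule mult_le_mono) (use n0 ppos [of j] in auto)
    moreover have "p ^ j * tdeg \<alpha>0 \<le> p ^ e * tdeg \<alpha>0"
      by (rule mult_le_mono1) (use j p in simp)
    then have "p ^ j * tdeg \<alpha>0 \<le> N"
      using N unfolding \<beta> tdeg_smul by simp
    ultimately show "smul (p ^ j) \<alpha>0 \<in> ?S"
      by simp
  qed
  then have "(\<Sum>\<alpha>\<in>?S. subst_monom \<alpha> (E \<alpha>) \<beta> x) =
      (\<Sum>\<alpha>\<in>?S - ?T. subst_monom \<alpha> (E \<alpha>) \<beta> x) + (\<Sum>\<alpha>\<in>?T. subst_monom \<alpha> (E \<alpha>) \<beta> x)"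
    by (rule sum.subset_diff) simp
  also have "(\<Sum>\<alpha>\<in>?T. subst_monom \<alpha> (E \<alpha>) \<beta> x) =
      (\<Sum>j\<le>e. subst_monom (smul (p ^ j) \<alpha>0) (E (smul (p ^ j) \<alpha>0)) \<beta> x)"
  proof (subst sum.reindex)
    have "i = j" if "smul (p ^ i) \<alpha>0 = smul (p ^ j) \<alpha>0" for i j
    proof -
      have "p ^ i * tdeg \<alpha>0 = p ^ j * tdeg \<alpha>0"
        using that by (metis tdeg_smul)
      moreover have "\<alpha>0 \<noteq> 0"
        using n0 by auto
      ultimately show ?thesis
        using p by simp
    qed
    then show "inj_on (\<lambda>j. smul (p ^ j) \<alpha>0) {..e}"
      by (auto simp: inj_on_def)
  qed simp
  also have "\<dots> = (\<Sum>j\<le>e. E (smul (p ^ j) \<alpha>0) (p ^ (e - j)) x)"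
  proof (intro sum.cong refl)
    fix j assume j: "j \<in> {..e}"
    have "\<beta> = smul (p ^ (e - j)) (smul (p ^ j) \<alpha>0)"
      using j by (simp add: smul_smul \<beta> pow)
    then show "subst_monom (smul (p ^ j) \<alpha>0) (E (smul (p ^ j) \<alpha>0)) \<beta> x =
        E (smul (p ^ j) \<alpha>0) (p ^ (e - j)) x"
      using n0 ppos [of j] by (simp add: subst_monom_smul)
  qed
  finally have eq: "(\<Sum>\<alpha>\<in>?S. subst_monom \<alpha> (E \<alpha>) \<beta> x) - (\<Sum>j\<le>e. E (smul (p ^ j) \<alpha>0) (p ^ (e - j)) x) =
      (\<Sum>\<alpha>\<in>?S - ?T. subst_monom \<alpha> (E \<alpha>) \<beta> x)"
    by simp
  have "subst_monom \<alpha> (E \<alpha>) \<beta> x \<in> I" if \<alpha>: "\<alpha> \<in> ?S - ?T" for \<alpha>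
  proof (cases "\<exists>c. \<beta> = smul c \<alpha>")
    case True
    then obtain c where c: "\<beta> = smul c \<alpha>" ..
    have "c \<noteq> p ^ f" if "f \<le> e" for f
    proof
      assume "c = p ^ f"
      then have "smul (p ^ f) \<alpha> = smul (p ^ f) (smul (p ^ (e - f)) \<alpha>0)"
        using c \<beta> pow [of "f"] that by (simp add: smul_smul mult.commute)
      with smul_cancel [OF ppos] have "\<alpha> = smul (p ^ (e - f)) \<alpha>0"
        by blast
      then show False
        using \<alpha> by auto
    qed
    then have "E \<alpha> c x \<in> I"
      using rest [of c \<alpha>] c \<alpha> by auto
    then show ?thesis
      using c \<alpha> n0 by (simp add: subst_monom_smul)
  next
    case False
    then show ?thesis
      by (simp add: subst_monom_eq_0 ideal_zero)
  qed
  then show ?thesis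
    unfolding eq by (rule ideal_sum)
qed

section \<open>Merging the factors at powers of \<open>p\<close>, and the induction on
  \<open>N\<close>\<close>

lemma ident2_log_below: "log_below N ident2"
  by (simp add: log_below_def ident2_def ideal_zero)

lemma HS_inf_logD: "E \<in> HS_inf_log N n \<Longrightarrow> E \<in> HS_inf s"
  "E \<in> HS_inf_log N n \<Longrightarrow> c * n < N \<Longrightarrow> x \<in> I \<Longrightarrow> E c x \<in> I"
  by (auto simp: HS_inf_log_def)

text \<open>\<open>T\<close> is the composite of the series F_i(t^(p^i)), formed along the axis.
  Each is logarithmic below p^e, so their obstructions add up; only the one with i = 0 has a term of
  degree 1.\<close>

lemma collect_ppowers:
  assumes F: "\<And>i. i \<le> e \<Longrightarrow> F i \<in> HS_inf_log (p ^ e) (p ^ i)"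
  shows "\<exists>T\<in>HS_inf_log (p ^ e) 1. T 1 = F 0 1 \<and>
    (\<forall>x\<in>I. T (p ^ e) x - (\<Sum>i\<le>e. F i (p ^ (e - i)) x) \<in> I)"
proof -
  have p: "p > 1"
    using prime by (rule prime_gt_1_nat)
  have ppos: "p ^ j > 0" for j
    using p by simp
  let ?G = "\<lambda>i. subst_monom (p ^ i, 0) (F i)"
  have "\<exists>Q\<in>HS2 s. log_below (p ^ e) Q \<and> (\<forall>\<beta>. tdeg \<beta> < 1 \<longrightarrow> Q \<beta> = ident2 \<beta>) \<and>
    (\<forall>\<beta> x. tdeg \<beta> = 1 \<longrightarrow> Q \<beta> x = ident2 \<beta> x + (\<Sum>i\<in>{..e}. ?G i \<beta> x)) \<and>
    (\<forall>\<beta> x. tdeg \<beta> = p ^ e \<longrightarrow> x \<in> I \<longrightarrow> Q \<beta> x - (ident2 \<beta> x + (\<Sum>i\<in>{..e}. ?G i \<beta> x)) \<in> I)"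
    using p HS_inf_logD(1) [OF F] F
    by (intro HS2_prod_exists ident2_HS2 [OF module] ident2_log_below subst_monom_HS2 [OF module]
        subst_monom_log_below) auto
  then obtain Q where Q: "Q \<in> HS2 s" "log_below (p ^ e) Q"
      "\<And>\<beta> x. tdeg \<beta> = 1 \<Longrightarrow> Q \<beta> x = ident2 \<beta> x + (\<Sum>i\<in>{..e}. ?G i \<beta> x)"
      "\<And>\<beta> x. tdeg \<beta> = p ^ e \<Longrightarrow> x \<in> I \<Longrightarrow> Q \<beta> x - (ident2 \<beta> x + (\<Sum>i\<in>{..e}. ?G i \<beta> x)) \<in> I"
    by blast
  show ?thesis
  proof (intro bexI [of _ "\<lambda>i. Q (i, 0)"] conjI ballI)
    show "(\<lambda>i. Q (i, 0)) \<in> HS_inf_log (p ^ e) 1"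
      using HS2_axis [OF module Q(1)] Q(2) by (simp add: HS_inf_log_def log_below_def)
    show "Q (1, 0) = F 0 1"
    proof
      fix x
      have "(\<Sum>i\<in>{..e}. ?G i (1, 0) x) = (\<Sum>i\<in>{..e}. if i = 0 then F 0 1 x else 0)"
        using ppos p by (intro sum.cong) (simp_all add: subst_monom_axis)
      then show "Q (1, 0) x = F 0 1 x"
        using Q(3) [of "(1, 0)" x] by (simp add: ident2_def zero_prod_def)
    qed
    fix x
    assume "x \<in> I"
    have "?G i (p ^ e, 0) x = F i (p ^ (e - i)) x" if "i \<le> e" for i
      using that ppos [of i] p by (simp add: subst_monom_axis le_imp_power_dvd power_diff)
    then have "(\<Sum>i\<in>{..e}. ?G i (p ^ e, 0) x) = (\<Sum>i\<le>e. F i (p ^ (e - i)) x)"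
      by (intro sum.cong) simp_all
    then show "Q (p ^ e, 0) x - (\<Sum>i\<le>e. F i (p ^ (e - i)) x) \<in> I"
      using Q(4) [of "(p ^ e, 0)" x] \<open>x \<in> I\<close> p by (simp add: ident2_def zero_prod_def)
  qed
qed

text \<open>Write N = p^e m with m > 1 prime to p. Factoring E(u + v) yields a series T whose
  obstruction at p^e is a unit multiple, modulo p, of that of \<open>E\<close> at \<open>N\<close>.
  Composing \<open>E\<close> with copies of T(t^m) cancels the obstruction, and m > 1 keeps the
  first term.\<close>

lemma integrable_non_ppower:
  assumes lti: "leading_terms_integrable N" and N: "N \<ge> 1" and npp: "\<And>e. N \<noteq> p ^ e"
    and E: "E \<in> HS_inf_log N 1"
  shows "\<exists>E'\<in>HS_inf_log (Suc N) 1. E' 1 = E 1"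
proof -
  have p: "p > 1"
    using prime by (rule prime_gt_1_nat)
  have Einf: "E \<in> HS_inf s"
    using E by (rule HS_inf_logD)
  define e where "e = multiplicity p N"
  obtain m where m: "N = p ^ e * m" "\<not> p dvd m"
    using multiplicity_decompose' [of N p] N p by (auto simp: e_def)
  have "m \<noteq> 0" "m \<noteq> 1"
    using m npp [of e] N by auto
  then have m2: "m \<ge> 2"
    by simp
  define C where "C = N choose (p ^ e)"
  have "\<not> p dvd C"
  proof -
    \<comment> \<open>\<open>const_p_fac\<close> gives \<open>C\<close> the same multiplicity of
      \<open>p\<close> as \<open>m\<close>.\<close>
    have "multiplicity p C = 0"
      using const_p_fac [of m p e] m m2 prime by (simp add: C_def not_dvd_imp_multiplicity_0)
    moreover have "C \<noteq> 0"
      using m m2 by (simp add: C_def)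
    ultimately show ?thesis
      using prime p by (simp add: multiplicity_eq_zero_iff)
  qed
  then have "gcd p C = 1"
    using prime prime_imp_coprime coprime_iff_gcd_eq_1 by blast
  \<comment> \<open>\<open>j\<close> is an inverse of -C modulo \<open>p\<close>. The sign makes
    \<open>j\<close> a number of copies to compose with, so no inverse derivation is taken.\<close>
  then obtain y j where j: "p * y = C * j + 1"
    using bezout_nat [of p C] p by auto
  have kill: "z + of_nat j * (of_nat C * z) = 0" for z :: 'a
  proof -
    have "z + of_nat j * (of_nat C * z) = of_nat (C * j + 1) * z"
      by (simp add: algebra_simps)
    also have "\<dots> = 0"
      unfolding j [symmetric] by (simp add: char)
    finally show ?thesis .
  qed
  \<comment> \<open>Thus \<beta> = (p^e, N - p^e). The coordinate 1 of \<open>\<alpha>0\<close>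
    forces every c with \<open>smul c \<alpha> = \<beta>\<close> to divide p^e, hence to be a power
    of p.\<close>
  define \<alpha>0 where "\<alpha>0 = (1::nat, m - 1)"
  define \<beta> where "\<beta> = smul (p ^ e) \<alpha>0"
  have \<alpha>0: "tdeg \<alpha>0 = m"
    using m2 by (simp add: \<alpha>0_def)
  have \<beta>: "tdeg \<beta> = N"
    by (simp add: \<beta>_def \<alpha>0 m(1))
  have logD: "log_below N (subst_sum E)"
    using HS_inf_logD(2) [OF E] by (simp add: log_below_def subst_sum_def ideal_mult)
  have agree: "subst_sum E \<gamma> = ident2 \<gamma>" if "tdeg \<gamma> < 1" for \<gamma>
    using that HS2_0 [OF subst_sum_HS2 [OF module Einf]] by (simp add: ident2_def)
  have "\<exists>F. (\<forall>\<alpha>. 1 \<le> tdeg \<alpha> \<longrightarrow> tdeg \<alpha> \<le> N \<longrightarrow> F \<alpha> \<in> HS_inf_log N (tdeg \<alpha>)) \<and>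
    (\<forall>\<alpha>. tdeg \<alpha> = 1 \<longrightarrow> 1 \<le> N \<longrightarrow> F \<alpha> 1 = (\<lambda>x. subst_sum E \<alpha> x - ident2 \<alpha> x)) \<and>
    (\<forall>\<beta> x. tdeg \<beta> = N \<longrightarrow> x \<in> I \<longrightarrow> subst_sum E \<beta> x -
      (ident2 \<beta> x + (\<Sum>\<alpha> | 1 \<le> tdeg \<alpha> \<and> tdeg \<alpha> \<le> N. subst_monom \<alpha> (F \<alpha>) \<beta> x)) \<in> I)"
    by (rule HS2_factor [OF order_refl _ subst_sum_HS2 [OF module Einf] logD N ident2_HS2 [OF module]
          ident2_log_below order_refl agree])
      (use lti in \<open>simp_all add: leading_terms_integrable_def\<close>)
  then obtain F where F: "\<And>\<alpha>. 1 \<le> tdeg \<alpha> \<Longrightarrow> tdeg \<alpha> \<le> N \<Longrightarrow> F \<alpha> \<in> HS_inf_log N (tdeg \<alpha>)"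
    "\<And>\<beta> x. tdeg \<beta> = N \<Longrightarrow> x \<in> I \<Longrightarrow> subst_sum E \<beta> x -
      (ident2 \<beta> x + (\<Sum>\<alpha> | 1 \<le> tdeg \<alpha> \<and> tdeg \<alpha> \<le> N. subst_monom \<alpha> (F \<alpha>) \<beta> x)) \<in> I"
    by blast
  have sum: "(\<Sum>\<alpha> | 1 \<le> tdeg \<alpha> \<and> tdeg \<alpha> \<le> N. subst_monom \<alpha> (F \<alpha>) \<beta> x) -
    (\<Sum>i\<le>e. F (smul (p ^ i) \<alpha>0) (p ^ (e - i)) x) \<in> I" for x
  proof (rule sum_subst_monom_ppower [OF \<beta>_def _ _ \<beta>])
    fix \<alpha> c
    assume "smul c \<alpha> = \<beta>"
    then have "c * fst \<alpha> = p ^ e"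
      by (simp add: \<beta>_def \<alpha>0_def smul_def)
    then have "c dvd p ^ e"
      by (metis dvd_triv_left)
    then show "(\<exists>f\<le>e. c = p ^ f) \<or> F \<alpha> c x \<in> I"
      using divides_primepow_nat [OF prime] by blast
  qed (use \<alpha>0 m2 in auto)
  \<comment> \<open>Dividing degrees by \<open>m\<close> turns the bound N into p^e.\<close>
  have "F (smul (p ^ i) \<alpha>0) \<in> HS_inf_log (p ^ e) (p ^ i)" if i: "i \<le> e" for i
  proof -
    have "1 \<le> tdeg (smul (p ^ i) \<alpha>0)" "tdeg (smul (p ^ i) \<alpha>0) \<le> N"
      using i p m2 by (simp_all add: \<alpha>0 m(1) Suc_le_eq)
    then have "F (smul (p ^ i) \<alpha>0) \<in> HS_inf_log N (p ^ i * m)"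
      using F(1) [of "smul (p ^ i) \<alpha>0"] \<alpha>0 by simp
    moreover have "c * (p ^ i * m) < N" if "c * p ^ i < p ^ e" for c
      using that m m2 by (simp flip: mult.assoc)
    ultimately show ?thesis
      by (auto simp: HS_inf_log_def)
  qed
  from collect_ppowers [of e "\<lambda>i. F (smul (p ^ i) \<alpha>0)", OF this]
  obtain T where T: "T \<in> HS_inf_log (p ^ e) 1"
    "\<And>x. x \<in> I \<Longrightarrow> T (p ^ e) x - (\<Sum>i\<le>e. F (smul (p ^ i) \<alpha>0) (p ^ (e - i)) x) \<in> I"
    by blast
  \<comment> \<open>Two expressions for the obstruction of E(u + v) at \<open>\<beta>\<close>:
    directly from the binomial coefficient, and from the factorization.\<close>
  have CE: "of_nat C * E N x - T (p ^ e) x \<in> I" if x: "x \<in> I" for x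
  proof -
    have "fst \<beta> = p ^ e"
      by (simp add: \<beta>_def \<alpha>0_def)
    moreover have "\<beta> \<noteq> 0"
      using \<beta> N by auto
    ultimately have "of_nat C * E N x -
        (\<Sum>\<alpha> | 1 \<le> tdeg \<alpha> \<and> tdeg \<alpha> \<le> N. subst_monom \<alpha> (F \<alpha>) \<beta> x) \<in> I"
      using F(2) [OF \<beta> x] \<beta> by (simp add: subst_sum_def ident2_def C_def)
    from ideal_diff [OF ideal_diff_trans [OF this sum] T(2) [OF x]] show ?thesis
      by simp
  qed
  \<comment> \<open>Substituting t^m moves the obstruction of \<open>T\<close> from degree p^e to
    degree N.\<close>
  have "T \<in> HS_inf_log N m"
    using T(1) m m2 by (auto simp: HS_inf_log_def mult.commute [of _ m])
  then have G: "subst_monom (m, 0) T \<in> HS2 s" "log_below N (subst_monom (m, 0) T)"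
    using m2 HS_inf_logD(1) [OF T(1)]
    by (auto intro!: subst_monom_HS2 [OF module] subst_monom_log_below)
  have P: "subst_monom (1, 0) E \<in> HS2 s" "log_below N (subst_monom (1, 0) E)"
    using Einf E by (auto intro!: subst_monom_HS2 [OF module] subst_monom_log_below)
  \<comment> \<open>The index set \<open>{..<j}\<close> only counts: all \<open>j\<close> factors
    are the same.\<close>
  have "\<exists>Q\<in>HS2 s. log_below N Q \<and> (\<forall>\<beta>. tdeg \<beta> < 1 \<longrightarrow> Q \<beta> = subst_monom (1, 0) E \<beta>) \<and>
    (\<forall>\<beta> x. tdeg \<beta> = 1 \<longrightarrow> Q \<beta> x = subst_monom (1, 0) E \<beta> x + (\<Sum>i\<in>{..<j}. subst_monom (m, 0) T \<beta> x)) \<and>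
    (\<forall>\<beta> x. tdeg \<beta> = N \<longrightarrow> x \<in> I \<longrightarrow>
      Q \<beta> x - (subst_monom (1, 0) E \<beta> x + (\<Sum>i\<in>{..<j}. subst_monom (m, 0) T \<beta> x)) \<in> I)"
    by (rule HS2_prod_exists [OF _ P N order_refl]) (use G in auto)
  then obtain Q where Q: "Q \<in> HS2 s" "log_below N Q"
    "\<And>\<beta> x. tdeg \<beta> = 1 \<Longrightarrow> Q \<beta> x = subst_monom (1, 0) E \<beta> x + (\<Sum>i\<in>{..<j}. subst_monom (m, 0) T \<beta> x)"
    "\<And>\<beta> x. tdeg \<beta> = N \<Longrightarrow> x \<in> I \<Longrightarrow>
      Q \<beta> x - (subst_monom (1, 0) E \<beta> x + (\<Sum>i\<in>{..<j}. subst_monom (m, 0) T \<beta> x)) \<in> I"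
    by blast
  have QN: "Q (N, 0) x \<in> I" if x: "x \<in> I" for x
  proof -
    have "Q (N, 0) x - (E N x + of_nat j * T (p ^ e) x) \<in> I"
      using Q(4) [of "(N, 0)" x] x m m2 by (simp add: subst_monom_axis)
    moreover have "of_nat j * (T (p ^ e) x - of_nat C * E N x) \<in> I"
      using ideal_mult [OF ideal_uminus [OF CE [OF x]]] by simp
    ultimately have "Q (N, 0) x - (E N x + of_nat j * T (p ^ e) x) +
        of_nat j * (T (p ^ e) x - of_nat C * E N x) \<in> I"
      by (rule ideal_add)
    also have "Q (N, 0) x - (E N x + of_nat j * T (p ^ e) x) +
        of_nat j * (T (p ^ e) x - of_nat C * E N x) =
        Q (N, 0) x - (E N x + of_nat j * (of_nat C * E N x))"
      by (simp add: algebra_simps)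
    finally show ?thesis
      by (simp add: kill)
  qed
  show ?thesis
  proof (intro bexI [of _ "\<lambda>i. Q (i, 0)"])
    show "Q (1, 0) = E 1"
      using Q(3) [of "(1, 0)"] m2 by (simp add: subst_monom_axis fun_eq_iff)
    show "(\<lambda>i. Q (i, 0)) \<in> HS_inf_log (Suc N) 1"
      using HS2_axis [OF module Q(1)] Q(2) QN
      by (auto simp: HS_inf_log_def log_below_def less_Suc_eq)
  qed
qed

text \<open>The only new requirement concerns c with c n = N, where n is the degree of \<alpha>. If
  c is not a power of p, \<open>integrable_non_ppower\<close> repairs the integral. If c = p^e, the
  factorization of \<open>D\<close> relative to \<open>P\<close> is compared at p^e \<alpha>, and
  its factors at p^i \<alpha> merge into a new integral.\<close>

lemma leading_terms_integrable_Suc: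
  assumes lti: "\<And>M. M \<le> N \<Longrightarrow> leading_terms_integrable M"
  shows "leading_terms_integrable (Suc N)"
  unfolding leading_terms_integrable_def
proof (intro ballI allI impI)
  fix D P \<alpha>
  assume D: "D \<in> HS2 s" and P: "P \<in> HS2 s" and lD: "log_below (Suc N) D"
    and lP: "log_below (Suc N) P" and agree: "\<forall>\<beta>. tdeg \<beta> < tdeg \<alpha> \<longrightarrow> D \<beta> = P \<beta>" and \<alpha>: "\<alpha> \<noteq> 0"
  have p: "p > 1"
    using prime by (rule prime_gt_1_nat)
  have l': "log_below N D" "log_below N P"
    using lD lP by (simp_all add: log_below_def)
  have n: "tdeg \<alpha> \<ge> 1"
    using \<alpha> by (simp add: Suc_le_eq flip: neq0_conv)
  \<comment> \<open>Factors already repaired for every multiplier \<open>c\<close> that is not a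
    power of \<open>p\<close>: modulo \<open>I\<close>, only powers of \<open>p\<close> are left in
    degree \<open>N\<close>.\<close>
  define good where "good n = {E \<in> HS_inf_log N n.
    \<forall>c. c * n = N \<longrightarrow> (\<forall>i. c \<noteq> p ^ i) \<longrightarrow> (\<forall>x\<in>I. E c x \<in> I)}" for n
  have sel: "\<exists>E\<in>good (tdeg \<alpha>). E 1 = (\<lambda>x. D \<alpha> x - P \<alpha> x)"
    if prems: "D \<in> HS2 s" "P \<in> HS2 s" "log_below N D" "log_below N P"
      "\<And>\<beta>. tdeg \<beta> < tdeg \<alpha> \<Longrightarrow> D \<beta> = P \<beta>" "\<alpha> \<noteq> 0" for D P \<alpha>
  proof -
    obtain E where E: "E \<in> HS_inf_log N (tdeg \<alpha>)" "E 1 = (\<lambda>x. D \<alpha> x - P \<alpha> x)"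
      using lti [OF order_refl, unfolded leading_terms_integrable_def, rule_format, OF prems] by blast
    have n: "tdeg \<alpha> > 0"
      using \<open>\<alpha> \<noteq> 0\<close> by (simp flip: neq0_conv)
    show ?thesis
    proof (cases "\<exists>c\<ge>1. c * tdeg \<alpha> = N \<and> (\<forall>i. c \<noteq> p ^ i)")
      case True
      then obtain c where c: "c \<ge> 1" "c * tdeg \<alpha> = N" "\<And>i. c \<noteq> p ^ i"
        by blast
      \<comment> \<open>In terms of multipliers the bound \<open>N\<close> becomes \<open>c\<close>,
        so the hypothesis is needed for \<open>c\<close>, which may be smaller than
        \<open>N\<close>.\<close>
      have lt: "k * tdeg \<alpha> < N \<longleftrightarrow> k < c" "k * tdeg \<alpha> = N \<longleftrightarrow> k = c" for k
        using \<open>\<alpha> \<noteq> 0\<close> n by (simp_all add: c(2) [symmetric])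
      have "c \<le> N"
        using n by (simp add: c(2) [symmetric])
      moreover have "E \<in> HS_inf_log c 1"
        using E(1) by (simp add: HS_inf_log_def lt)
      ultimately obtain E' where E': "E' \<in> HS_inf_log (Suc c) 1" "E' 1 = E 1"
        using integrable_non_ppower [OF lti c(1,3)] by blast
      then have "E' \<in> good (tdeg \<alpha>)"
        by (simp add: good_def HS_inf_log_def lt)
      then show ?thesis
        using E E' by auto
    next
      case False
      have "E c x \<in> I" if "c * tdeg \<alpha> = N" "\<forall>i. c \<noteq> p ^ i" "x \<in> I" for c x
      \<comment> \<open>The multiplier 0 occurs when \<open>N = 0\<close>; it is not a power of
        \<open>p\<close>, and its coefficient is the identity.\<close>
      proof (cases "c = 0")
        case True
        then show ?thesis
          using HS_inf_0 [OF HS_inf_logD(1) [OF E(1)]] that by simp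
      qed (use False that in auto)
      then show ?thesis
        using E by (auto simp: good_def)
    qed
  qed
  obtain E where E: "E \<in> good (tdeg \<alpha>)" "E 1 = (\<lambda>x. D \<alpha> x - P \<alpha> x)"
    using sel [OF D P l'] agree \<alpha> by blast
  show "\<exists>E\<in>HS_inf_log (Suc N) (tdeg \<alpha>). E 1 = (\<lambda>x. D \<alpha> x - P \<alpha> x)"
  proof (cases "\<exists>e. p ^ e * tdeg \<alpha> = N")
    case False
    then have "E \<in> HS_inf_log (Suc N) (tdeg \<alpha>)"
      using E(1) by (auto simp: good_def HS_inf_log_def less_Suc_eq)
    then show ?thesis
      using E by blast
  next
    case True
    then obtain e where e: "p ^ e * tdeg \<alpha> = N" ..
    have N: "N \<ge> 1" and nN: "tdeg \<alpha> \<le> N"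
      using n p by (simp_all add: e [symmetric] Suc_le_eq)
    have lt: "k * tdeg \<alpha> < N \<longleftrightarrow> k < p ^ e" for k
      using n by (simp add: e [symmetric])
    \<comment> \<open>Starting in degree \<open>tdeg \<alpha>\<close> makes the leading term of the
      factor at \<open>\<alpha>\<close> the one to be integrated.\<close>
    have "\<exists>F. (\<forall>\<gamma>. tdeg \<alpha> \<le> tdeg \<gamma> \<longrightarrow> tdeg \<gamma> \<le> N \<longrightarrow> F \<gamma> \<in> good (tdeg \<gamma>)) \<and>
      (\<forall>\<gamma>. tdeg \<gamma> = tdeg \<alpha> \<longrightarrow> tdeg \<alpha> \<le> N \<longrightarrow> F \<gamma> 1 = (\<lambda>x. D \<gamma> x - P \<gamma> x)) \<and>
      (\<forall>\<beta> x. tdeg \<beta> = N \<longrightarrow> x \<in> I \<longrightarrow> D \<beta> x -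
        (P \<beta> x + (\<Sum>\<gamma> | tdeg \<alpha> \<le> tdeg \<gamma> \<and> tdeg \<gamma> \<le> N. subst_monom \<gamma> (F \<gamma>) \<beta> x)) \<in> I)"
    proof (rule HS2_factor [where good = good, OF _ _ D l'(1) N P l'(2) n])
      show "good n \<subseteq> HS_inf_log N n" for n
        by (auto simp: good_def)
    qed (rule sel, assumption+, use agree in blast)
    then obtain F where F: "\<And>\<gamma>. tdeg \<alpha> \<le> tdeg \<gamma> \<Longrightarrow> tdeg \<gamma> \<le> N \<Longrightarrow> F \<gamma> \<in> good (tdeg \<gamma>)"
      "F \<alpha> 1 = (\<lambda>x. D \<alpha> x - P \<alpha> x)"
      "\<And>\<beta> x. tdeg \<beta> = N \<Longrightarrow> x \<in> I \<Longrightarrow> D \<beta> x -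
        (P \<beta> x + (\<Sum>\<gamma> | tdeg \<alpha> \<le> tdeg \<gamma> \<and> tdeg \<gamma> \<le> N. subst_monom \<gamma> (F \<gamma>) \<beta> x)) \<in> I"
      using nN by blast
    define \<beta> where "\<beta> = smul (p ^ e) \<alpha>"
    have \<beta>: "tdeg \<beta> = N"
      by (simp add: \<beta>_def e)
    have S: "(\<Sum>i\<le>e. F (smul (p ^ i) \<alpha>) (p ^ (e - i)) x) \<in> I" if x: "x \<in> I" for x
    proof -
      let ?\<Sigma> = "\<Sum>\<gamma> | tdeg \<alpha> \<le> tdeg \<gamma> \<and> tdeg \<gamma> \<le> N. subst_monom \<gamma> (F \<gamma>) \<beta> x"
      have "?\<Sigma> - (\<Sum>i\<le>e. F (smul (p ^ i) \<alpha>) (p ^ (e - i)) x) \<in> I"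
      proof (rule sum_subst_monom_ppower [OF \<beta>_def n order_refl \<beta>])
        fix \<gamma> c
        assume c: "smul c \<gamma> = \<beta>" and \<gamma>: "tdeg \<alpha> \<le> tdeg \<gamma>"
        then have cN: "c * tdeg \<gamma> = N"
          using \<beta> by auto
        then have "tdeg \<gamma> \<le> N"
          using N by (cases c) auto
        then have F\<gamma>: "F \<gamma> \<in> good (tdeg \<gamma>)"
          using F(1) \<gamma> by blast
        show "(\<exists>f\<le>e. c = p ^ f) \<or> F \<gamma> c x \<in> I"
        proof (cases "\<exists>f. c = p ^ f")
          case True
          then obtain f where f: "c = p ^ f" ..
          \<comment> \<open>The degree of \<open>\<gamma>\<close> is at least that of
            \<open>\<alpha>\<close>, which bounds \<open>f\<close> by \<open>e\<close>.\<close>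
          have "p ^ f * tdeg \<alpha> \<le> p ^ e * tdeg \<alpha>"
            using cN \<gamma> f e by (metis mult_le_mono2)
          then have "f \<le> e"
            using n p by simp
          then show ?thesis
            using f by blast
        next
          case False
          then show ?thesis
            using F\<gamma> cN x by (auto simp: good_def)
        qed
      qed
      \<comment> \<open>\<open>D\<close> and \<open>P\<close> are logarithmic below
        \<open>Suc N\<close>, so neither has an obstruction in degree \<open>N\<close>.\<close>
      moreover have "?\<Sigma> \<in> I"
      proof -
        have "D \<beta> x \<in> I" "P \<beta> x \<in> I"
          using lD lP x \<beta> by (simp_all add: log_below_def)
        then have "D \<beta> x - P \<beta> x - (D \<beta> x - (P \<beta> x + ?\<Sigma>)) \<in> I"
          by (intro ideal_diff [OF ideal_diff F(3) [OF \<beta> x]])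
        then show ?thesis
          by simp
      qed
      ultimately show ?thesis
        using ideal_diff_iff by blast
    qed
    have "F (smul (p ^ i) \<alpha>) \<in> HS_inf_log (p ^ e) (p ^ i)" if i: "i \<le> e" for i
    proof -
      have "p ^ i \<le> p ^ e" "1 \<le> p ^ i"
        using i p by simp_all
      then have "p ^ i * tdeg \<alpha> \<le> N" "1 * tdeg \<alpha> \<le> p ^ i * tdeg \<alpha>"
        unfolding e [symmetric] by (auto intro: mult_le_mono1)
      then have "F (smul (p ^ i) \<alpha>) \<in> good (p ^ i * tdeg \<alpha>)"
        using F(1) [of "smul (p ^ i) \<alpha>"] by simp
      then show ?thesis
        by (auto simp: good_def HS_inf_log_def lt mult.assoc [symmetric])
    qed
    \<comment> \<open>The series with index 0 is the factor at \<open>\<alpha>\<close>, so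
      \<open>T\<close> keeps the required leading term.\<close>
    from collect_ppowers [of e "\<lambda>i. F (smul (p ^ i) \<alpha>)", OF this]
    obtain T where T: "T \<in> HS_inf_log (p ^ e) 1" "T 1 = F \<alpha> 1"
      "\<And>x. x \<in> I \<Longrightarrow> T (p ^ e) x - (\<Sum>i\<le>e. F (smul (p ^ i) \<alpha>) (p ^ (e - i)) x) \<in> I"
      by auto
    have "T (p ^ e) x \<in> I" if "x \<in> I" for x
      using ideal_diff_iff [OF T(3)] S that by blast
    moreover have "k * tdeg \<alpha> < Suc N \<longleftrightarrow> k < p ^ e \<or> k = p ^ e" for k
      using \<alpha> lt [of k] by (auto simp: less_Suc_eq simp flip: e)
    ultimately have "T \<in> HS_inf_log (Suc N) (tdeg \<alpha>)"
      using T(1) by (auto simp: HS_inf_log_def)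
    then show ?thesis
      using T(2) F(2) by auto
  qed
qed

text \<open>For \<open>N = 0\<close> nothing is asked about the ideal and
  \<open>HS2_diff_integrable\<close> suffices.\<close>

lemma leading_terms_integrable: "leading_terms_integrable N"
proof (induction N rule: less_induct)
  case (less N)
  show ?case
  proof (cases N)
    case 0
    show ?thesis
      unfolding leading_terms_integrable_def
    proof (intro ballI allI impI)
      fix D P \<alpha>
      assume "D \<in> HS2 s" "P \<in> HS2 s" "\<forall>\<beta>. tdeg \<beta> < tdeg \<alpha> \<longrightarrow> D \<beta> = P \<beta>" "\<alpha> \<noteq> 0"
      then have "\<exists>E\<in>HS_inf s. E 1 = (\<lambda>x. D \<alpha> x - P \<alpha> x)"
        by (intro HS2_diff_integrable [OF _ _ _ _ refl]) (auto simp: Suc_le_eq simp flip: neq0_conv)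
      then show "\<exists>E\<in>HS_inf_log N (tdeg \<alpha>). E 1 = (\<lambda>x. D \<alpha> x - P \<alpha> x)"
        by (simp add: HS_inf_log_def 0)
    qed
  next
    case (Suc M)
    then show ?thesis
      using leading_terms_integrable_Suc [of M] less.IH by simp
  qed
qed

section \<open>Division by a derivation, and splitting off \<open>T[p]\<close>\<close>

lemma HS2_quotient:
  assumes D: "D \<in> HS2 s" and X: "X \<in> HS2 s"
  shows "\<exists>F\<in>HS2 s. \<forall>\<beta>. tdeg \<beta> < n \<longrightarrow> comp2 X F \<beta> = D \<beta>"
\<comment> \<open>Left division by \<open>X\<close>, degree by degree: since \<open>X 0\<close> is
  the identity, changing \<open>F\<close> in degree \<open>n\<close> changes the composite there by
  the same amount. The remaining difference from \<open>D\<close> is a derivation, so it can be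
  absorbed by new factors of \<open>F\<close>.\<close>
proof (induction n)
  case 0
  then show ?case
    using ident2_HS2 [OF module] by auto
next
  case (Suc n)
  then obtain F where F: "F \<in> HS2 s" "\<And>\<beta>. tdeg \<beta> < n \<Longrightarrow> comp2 X F \<beta> = D \<beta>"
    by blast
  have XF: "comp2 X F \<in> HS2 s"
    by (rule comp2_HS2 [OF module X F(1)])
  show ?case
  proof (cases "n = 0")
    case True
    moreover have "comp2 X F 0 = D 0"
      using HS2_0 [OF XF] HS2_0 [OF D] by simp
    ultimately show ?thesis
      by (intro bexI [OF _ F(1)]) simp
  next
    case False
    then have n: "n \<ge> 1"
      by simp
    \<comment> \<open>The degree 0 term is the identity; with bound 1,
      \<open>HS2_prod_exists\<close> therefore applies to arbitrary derivations.\<close>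
    have log1: "log_below 1 P" if "P \<in> HS2 s" for P
      using HS2_0 [OF that] by (simp add: log_below_def)
    have "\<exists>E. \<forall>\<alpha>. tdeg \<alpha> = n \<longrightarrow> E \<alpha> \<in> HS_inf s \<and> E \<alpha> 1 = (\<lambda>x. D \<alpha> x - comp2 X F \<alpha> x)"
      using HS2_diff_integrable [OF D XF n] F(2) by (intro choice) metis
    then obtain E where E: "\<And>\<alpha>. tdeg \<alpha> = n \<Longrightarrow> E \<alpha> \<in> HS_inf s"
      "\<And>\<alpha>. tdeg \<alpha> = n \<Longrightarrow> E \<alpha> 1 = (\<lambda>x. D \<alpha> x - comp2 X F \<alpha> x)"
      by blast
    let ?S = "{\<alpha>. tdeg \<alpha> = n}"
    have "\<exists>Q\<in>HS2 s. log_below 1 Q \<and> (\<forall>\<beta>. tdeg \<beta> < n \<longrightarrow> Q \<beta> = F \<beta>) \<and>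
      (\<forall>\<beta> x. tdeg \<beta> = n \<longrightarrow> Q \<beta> x = F \<beta> x + (\<Sum>\<alpha>\<in>?S. subst_monom \<alpha> (E \<alpha>) \<beta> x)) \<and>
      (\<forall>\<beta> x. tdeg \<beta> = 1 \<longrightarrow> x \<in> I \<longrightarrow> Q \<beta> x - (F \<beta> x + (\<Sum>\<alpha>\<in>?S. subst_monom \<alpha> (E \<alpha>) \<beta> x)) \<in> I)"
      using n E
      by (intro HS2_prod_exists F log1 subst_monom_HS2 [OF module] subst_monom_low) auto
    then obtain Q where Q: "Q \<in> HS2 s" "\<And>\<beta>. tdeg \<beta> < n \<Longrightarrow> Q \<beta> = F \<beta>"
      "\<And>\<beta> x. tdeg \<beta> = n \<Longrightarrow> Q \<beta> x = F \<beta> x + (\<Sum>\<alpha>\<in>?S. subst_monom \<alpha> (E \<alpha>) \<beta> x)"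
      by blast
    have "comp2 X Q \<beta> = D \<beta>" if \<beta>: "tdeg \<beta> < Suc n" for \<beta>
    proof (cases "\<beta> = 0")
      case True
      then show ?thesis
        using HS2_0 [OF comp2_HS2 [OF module X Q(1)]] HS2_0 [OF D] by simp
    next
      case nz: False
      have "(\<Sum>(i, j)\<in>antidiag \<beta> - {(0, \<beta>), (\<beta>, 0)}. X i (Q j x)) =
          (\<Sum>(i, j)\<in>antidiag \<beta> - {(0, \<beta>), (\<beta>, 0)}. X i (F j x))" for x
      proof (intro sum.cong refl)
        fix ij
        assume "ij \<in> antidiag \<beta> - {(0, \<beta>), (\<beta>, 0)}"
        then show "(case ij of (i, j) \<Rightarrow> X i (Q j x)) = (case ij of (i, j) \<Rightarrow> X i (F j x))"
          by (cases rule: antidiag_interior_cases) (use Q(2) \<beta> in simp)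
      qed
      then have eq: "comp2 X Q \<beta> x = comp2 X F \<beta> x + (Q \<beta> x - F \<beta> x)" for x
        using HS2_0 [OF X] HS2_0 [OF Q(1)] HS2_0 [OF F(1)]
        by (simp add: comp2_def sum_antidiag_ends [OF nz])
      show ?thesis
      proof (cases "tdeg \<beta> < n")
        case True
        then show ?thesis
          using F(2) Q(2) eq by (simp add: fun_eq_iff)
      next
        case False
        then have \<beta>n: "tdeg \<beta> = n"
          using \<beta> by simp
        have "(\<Sum>\<alpha>\<in>?S. subst_monom \<alpha> (E \<alpha>) \<beta> x) = (\<Sum>\<alpha>\<in>?S. if \<alpha> = \<beta> then E \<beta> 1 x else 0)" for x
          using \<beta>n n by (intro sum.cong) (auto simp: subst_monom_same_deg)
        then have "(\<Sum>\<alpha>\<in>?S. subst_monom \<alpha> (E \<alpha>) \<beta> x) = D \<beta> x - comp2 X F \<beta> x" for x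
          using \<beta>n E(2) by simp
        then show ?thesis
          using Q(3) [OF \<beta>n] eq by (simp add: fun_eq_iff)
      qed
    qed
    then show ?thesis
      using Q(1) by blast
  qed
qed

text \<open>As \<open>D 1\<close> vanishes, the factorization of \<open>D\<close> starts in degree
  2, and only exponents divisible by \<open>p\<close> contribute at (p^l, 0). Merged, their factors
  form \<open>T[p]\<close>, which has the same obstruction as \<open>D\<close>; so the quotient
  preserves \<open>I\<close> up to and including degree p^l.\<close>

lemma HS_inf_dilation_factor:
  assumes D: "D \<in> HS_inf_log (p ^ l) 1" and D1: "D 1 = (\<lambda>_. 0)" and l: "l \<ge> 1"
  shows "\<exists>T\<in>HS_inf_log (p ^ (l - 1)) 1. \<exists>F\<in>HS_inf_log (Suc (p ^ l)) 1. F 1 = (\<lambda>_. 0) \<and>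
    (\<forall>c\<le>p ^ l. \<forall>x. D c x = (\<Sum>i\<le>c. hs_dilate p T i (F (c - i) x)))"
proof -
  have p: "p > 1"
    using prime by (rule prime_gt_1_nat)
  obtain e where e: "l = Suc e"
    using l by (cases l) auto
  define N where "N = p ^ l"
  have N: "N \<ge> 1" "N = p ^ e * p"
    using p by (simp_all add: N_def e Suc_le_eq)
  have Dinf: "D \<in> HS_inf s"
    using D by (rule HS_inf_logD)
  let ?D = "subst_monom (1, 0) D"
  have D2: "?D \<in> HS2 s" "log_below N ?D"
    using Dinf D by (auto intro!: subst_monom_HS2 [OF module] subst_monom_log_below simp: N_def)
  have agree: "?D \<gamma> = ident2 \<gamma>" if "tdeg \<gamma> < 2" for \<gamma>
  proof (cases "\<gamma> = 0")
    case True
    then show ?thesis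
      using HS2_0 [OF D2(1)] by (simp add: ident2_def)
  next
    case False
    then have "tdeg \<gamma> = 1"
      using that by (metis less_2_cases One_nat_def tdeg_eq_0_iff)
    then show ?thesis
      using subst_monom_same_deg [of \<gamma> "(1, 0)" D] D1 False by (simp add: ident2_def)
  qed
  have "\<exists>F. (\<forall>\<alpha>. 2 \<le> tdeg \<alpha> \<longrightarrow> tdeg \<alpha> \<le> N \<longrightarrow> F \<alpha> \<in> HS_inf_log N (tdeg \<alpha>)) \<and>
    (\<forall>\<alpha>. tdeg \<alpha> = 2 \<longrightarrow> 2 \<le> N \<longrightarrow> F \<alpha> 1 = (\<lambda>x. ?D \<alpha> x - ident2 \<alpha> x)) \<and>
    (\<forall>\<beta> x. tdeg \<beta> = N \<longrightarrow> x \<in> I \<longrightarrow> ?D \<beta> x -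
      (ident2 \<beta> x + (\<Sum>\<alpha> | 2 \<le> tdeg \<alpha> \<and> tdeg \<alpha> \<le> N. subst_monom \<alpha> (F \<alpha>) \<beta> x)) \<in> I)"
    by (rule HS2_factor [OF order_refl _ D2 N(1) ident2_HS2 [OF module] ident2_log_below _ agree])
      (use leading_terms_integrable [of N] in \<open>simp_all add: leading_terms_integrable_def\<close>)
  then obtain F where F: "\<And>\<alpha>. 2 \<le> tdeg \<alpha> \<Longrightarrow> tdeg \<alpha> \<le> N \<Longrightarrow> F \<alpha> \<in> HS_inf_log N (tdeg \<alpha>)"
    "\<And>\<beta> x. tdeg \<beta> = N \<Longrightarrow> x \<in> I \<Longrightarrow> ?D \<beta> x -
      (ident2 \<beta> x + (\<Sum>\<alpha> | 2 \<le> tdeg \<alpha> \<and> tdeg \<alpha> \<le> N. subst_monom \<alpha> (F \<alpha>) \<beta> x)) \<in> I"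
    by blast
  \<comment> \<open>With base exponent (p, 0), the merged series is a series in u^p, and p^e takes
    the place of p^l.\<close>
  define \<alpha>0 where "\<alpha>0 = (p, 0::nat)"
  have \<alpha>0: "tdeg \<alpha>0 = p"
    by (simp add: \<alpha>0_def)
  have \<beta>: "(N, 0) = smul (p ^ e) \<alpha>0" "tdeg (N, 0) = N"
    by (simp_all add: N \<alpha>0_def)
  have sum: "(\<Sum>\<alpha> | 2 \<le> tdeg \<alpha> \<and> tdeg \<alpha> \<le> N. subst_monom \<alpha> (F \<alpha>) (N, 0) x) -
    (\<Sum>i\<le>e. F (smul (p ^ i) \<alpha>0) (p ^ (e - i)) x) \<in> I" for x
  proof (rule sum_subst_monom_ppower [OF \<beta>(1) _ _ \<beta>(2)])
    fix \<alpha> c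
    assume c: "smul c \<alpha> = (N, 0)" and 2: "2 \<le> tdeg \<alpha>"
    have cN: "c * tdeg \<alpha> = p ^ l"
      using arg_cong [OF c, of tdeg] by (simp add: N_def)
    then have "c dvd p ^ l"
      by (metis dvd_triv_left)
    then obtain f where f: "f \<le> l" "c = p ^ f"
      using divides_primepow_nat [OF prime] by blast
    \<comment> \<open>f = l would give \<open>\<alpha>\<close> degree 1, which the start in degree 2
      excludes.\<close>
    moreover have "f \<noteq> l"
      using cN 2 f p by auto
    ultimately show "(\<exists>f\<le>e. c = p ^ f) \<or> F \<alpha> c x \<in> I"
      using e by (intro disjI1 exI [of _ f]) simp
  qed (use \<alpha>0 p in auto)
  have "F (smul (p ^ i) \<alpha>0) \<in> HS_inf_log (p ^ e) (p ^ i)" if i: "i \<le> e" for i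
  proof -
    have "p ^ i \<le> p ^ e" "1 \<le> p ^ i"
      using i p by simp_all
    then have "p ^ i * p \<le> p ^ e * p" "1 * p \<le> p ^ i * p"
      by (auto intro: mult_le_mono1)
    then have "2 \<le> tdeg (smul (p ^ i) \<alpha>0)" "tdeg (smul (p ^ i) \<alpha>0) \<le> N"
      using p unfolding tdeg_smul \<alpha>0 N(2) by linarith+
    then have "F (smul (p ^ i) \<alpha>0) \<in> HS_inf_log N (p ^ i * p)"
      using F(1) [of "smul (p ^ i) \<alpha>0"] \<alpha>0 by simp
    moreover have "c * (p ^ i * p) < N" if "c * p ^ i < p ^ e" for c
      using that p by (simp add: N(2) flip: mult.assoc)
    ultimately show ?thesis
      by (auto simp: HS_inf_log_def)
  qed
  from collect_ppowers [of e "\<lambda>i. F (smul (p ^ i) \<alpha>0)", OF this]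
  obtain T where T: "T \<in> HS_inf_log (p ^ e) 1"
    "\<And>x. x \<in> I \<Longrightarrow> T (p ^ e) x - (\<Sum>i\<le>e. F (smul (p ^ i) \<alpha>0) (p ^ (e - i)) x) \<in> I"
    by blast
  have DT: "D N x - T (p ^ e) x \<in> I" if x: "x \<in> I" for x
  proof -
    have "D N x - (\<Sum>\<alpha> | 2 \<le> tdeg \<alpha> \<and> tdeg \<alpha> \<le> N. subst_monom \<alpha> (F \<alpha>) (N, 0) x) \<in> I"
      using F(2) [OF \<beta>(2) x] N(1) by (simp add: subst_monom_axis ident2_def zero_prod_def)
    from ideal_diff [OF ideal_diff_trans [OF this sum] T(2) [OF x]] show ?thesis
      by simp
  qed
  let ?X = "subst_monom (p, 0) T"
  have X: "?X \<in> HS2 s"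
    using T(1) p by (intro subst_monom_HS2 [OF module] HS_inf_logD(1)) auto
  have dil: "?X (i, 0) = hs_dilate p T i" for i
    using p by (simp add: subst_monom_axis hs_dilate_def)
  obtain Q where Q: "Q \<in> HS2 s" "\<And>\<beta>. tdeg \<beta> < Suc N \<Longrightarrow> comp2 ?X Q \<beta> = ?D \<beta>"
    using HS2_quotient [OF D2(1) X, of "Suc N"] by blast
  define G where "G i = Q (i, 0)" for i
  have G: "G \<in> HS_inf s"
    using HS2_axis [OF module Q(1)] by (simp add: G_def [abs_def])
  have DG: "D c x = (\<Sum>i\<le>c. hs_dilate p T i (G (c - i) x))" if "c \<le> N" for c x
  proof -
    have "D c x = ?D (c, 0) x"
      by (simp add: subst_monom_axis)
    also have "\<dots> = comp2 ?X Q (c, 0) x"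
      using Q(2) [of "(c, 0)"] that by simp
    finally show ?thesis
      by (simp only: comp2_axis dil G_def)
  qed
  have T0: "T 0 = id"
    by (rule HS_inf_0 [OF HS_inf_logD(1) [OF T(1)]])
  \<comment> \<open>As \<open>T 0\<close> is the identity, the factorization can be solved for
    \<open>G c\<close> in terms of lower terms of \<open>G\<close>.\<close>
  have DG': "G c x = D c x - (\<Sum>i\<in>{1..c}. hs_dilate p T i (G (c - i) x))" if "c \<le> N" for c x
  proof -
    have "{..c} = insert 0 {1..c}"
      by auto
    then show ?thesis
      using DG [OF that] by (simp add: hs_dilate_def T0)
  qed
  have Xlog: "hs_dilate p T i x \<in> I" if "i < N" "x \<in> I" for i x
  proof (cases "p dvd i")
    case True
    then obtain k where "i = p * k" ..
    then show ?thesis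
      using that p HS_inf_logD(2) [OF T(1), of k x] by (simp add: hs_dilate_def N(2) mult.commute)
  qed (simp add: hs_dilate_def ideal_zero)
  have Glog: "G c x \<in> I" if "c \<le> N" "x \<in> I" for c x
    using that
  proof (induction c arbitrary: x rule: less_induct)
    case (less c)
    have G0: "G 0 = id"
      by (rule HS_inf_0 [OF G])
    consider "c = 0" | "0 < c" "c < N" | "c = N"
      using less.prems by linarith
    then show ?case
    proof cases
      case 1
      then show ?thesis
        using G0 less.prems by simp
    next
      case 2
      have "(\<Sum>i\<in>{1..c}. hs_dilate p T i (G (c - i) x)) \<in> I"
        using 2 less by (intro ideal_sum Xlog) auto
      moreover have "D c x \<in> I"
        using HS_inf_logD(2) [OF D, of c x] 2 less.prems by (simp add: N_def)
      ultimately show ?thesis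
        unfolding DG' [OF less.prems(1)] by (rule ideal_diff [rotated])
    next
      case 3
      \<comment> \<open>In degree \<open>N\<close> the terms with \<open>i < N\<close> lie in
        \<open>I\<close> by induction; the term with \<open>i = N\<close> is
        \<open>T (p ^ e) x\<close>, which cancels \<open>D N x\<close> modulo
        \<open>I\<close>.\<close>
      have "{1..c} = insert c {1..<c}"
        using 3 N by auto
      then have sum: "(\<Sum>i\<in>{1..c}. hs_dilate p T i (G (c - i) x)) =
          T (p ^ e) x + (\<Sum>i\<in>{1..<c}. hs_dilate p T i (G (c - i) x))"
        using p 3 by (simp add: G0 hs_dilate_def N(2))
      have "(\<Sum>i\<in>{1..<c}. hs_dilate p T i (G (c - i) x)) \<in> I"
        using 3 less by (intro ideal_sum Xlog) auto
      then have "D c x - T (p ^ e) x - (\<Sum>i\<in>{1..<c}. hs_dilate p T i (G (c - i) x)) \<in> I"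
        unfolding 3 using DT less.prems by (intro ideal_diff [of "D N x - T (p ^ e) x"]) auto
      then show ?thesis
        unfolding DG' [OF less.prems(1)] sum by (simp only: diff_diff_add)
    qed
  qed
  show ?thesis
  proof (intro bexI conjI allI impI)
    show "T \<in> HS_inf_log (p ^ (l - 1)) 1"
      using T(1) by (simp add: e)
    show "G \<in> HS_inf_log (Suc (p ^ l)) 1"
      using G Glog by (simp add: HS_inf_log_def N_def less_Suc_eq_le)
    show "G 1 = (\<lambda>_. 0)"
    proof
      fix x
      \<comment> \<open>Since p > 1, \<open>T[p]\<close> has no term of degree 1.\<close>
      have "G 1 x = D 1 x - hs_dilate p T 1 (G 0 x)"
        using DG' [of 1 x] N(1) by simp
      then show "G 1 x = 0"
        using p D1 by (simp add: hs_dilate_def)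
    qed
    show "D c x = (\<Sum>i\<le>c. hs_dilate p T i (G (c - i) x))" if "c \<le> p ^ l" for c x
      using DG that by (simp add: N_def)
  qed
qed

end

section \<open>Factorization in finite length\<close>

text \<open>With \<open>D 0 = id\<close>, any difference from \<open>hs_id\<close> occurs at a
  positive index, so the least element is attained; for \<open>hs_id\<close> both sides
  hold.\<close>

lemma hs_ell_gt_1_iff:
  assumes "D 0 = id"
  shows "hs_ell D > 1 \<longleftrightarrow> D 1 = (\<lambda>_. 0)"
proof (cases "D = hs_id")
  case True
  then show ?thesis
    by (simp add: hs_ell_def hs_id_def one_enat_def)
next
  case False
  then obtain h where "D h \<noteq> hs_id h"
    by blast
  then have ex: "1 \<le> h \<and> D h \<noteq> (\<lambda>_. 0)"
    using assms by (cases "h = 0") (auto simp: hs_id_def)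
  define m where "m = (LEAST h. 1 \<le> h \<and> D h \<noteq> (\<lambda>_. 0))"
  have m: "1 \<le> m" "D m \<noteq> (\<lambda>_. 0)"
    using LeastI [of "\<lambda>h. 1 \<le> h \<and> D h \<noteq> (\<lambda>_. 0)", OF ex] by (simp_all add: m_def)
  have "m \<le> 1" if "D 1 \<noteq> (\<lambda>_. 0)"
    unfolding m_def using that by (intro Least_le) simp
  moreover have "m \<noteq> 1" if "D 1 = (\<lambda>_. 0)"
    using m(2) that by auto
  ultimately have "1 < m \<longleftrightarrow> D 1 = (\<lambda>_. 0)"
    using m(1) by (cases "D 1 = (\<lambda>_. 0)") auto
  then show ?thesis
    using False by (simp add: hs_ell_def one_enat_def m_def)
qed

text \<open>Entries beyond the length become zero, as the encoding in \<open>HS\<close>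
  demands.\<close>

definition hs_truncate :: "nat \<Rightarrow> (nat \<Rightarrow> 'a \<Rightarrow> 'a) \<Rightarrow> nat \<Rightarrow> 'a \<Rightarrow> 'a::comm_ring_1" where
  "hs_truncate m D i = (if i \<le> m then D i else (\<lambda>_. 0))"

lemma hs_truncate_HS: "D \<in> HS_inf s \<Longrightarrow> hs_truncate m D \<in> HS s m"
  by (auto simp: HS_inf_def HS_def hs_truncate_def intro!: sum.cong)

theorem corollary2p10:
  fixes p l :: nat
    and I :: "('n::finite, 'k::comm_ring_1) mvpoly set"
    and D :: "nat \<Rightarrow> ('n, 'k) mvpoly \<Rightarrow> ('n, 'k) mvpoly"
  assumes "prime p"
    and "CHAR('k) = p"
    and "is_ideal I"
    and "l \<ge> 1"
    and "D \<in> HS poly_scale (p ^ l)"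
    and "logarithmic_upto (p ^ l - 1) I D"
    and "hs_ell D > 1"
  shows "\<exists>F T. F \<in> HS_log poly_scale I (p ^ l) \<and> hs_ell F > 1 \<and>
    T \<in> HS poly_scale (p ^ (l - 1)) \<and> logarithmic_upto (p ^ (l - 1) - 1) I T \<and>
    D = hs_comp (p ^ l) (hs_dilate p T) F"
proof -
  interpret hs_ideal "poly_scale :: 'k \<Rightarrow> ('n, 'k) mvpoly \<Rightarrow> _" I p
  proof (rule hs_ideal.intro)
    have "of_nat p = (Poly_Mapping.single 0 (of_nat p) :: ('n, 'k) mvpoly)"
      by (simp add: single_of_nat)
    also have "(of_nat p :: 'k) = 0"
      using assms(2) by (metis of_nat_CHAR)
    finally show "of_nat p = (0 :: ('n, 'k) mvpoly)"
      by simp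
    fix \<delta> :: "('n, 'k) mvpoly \<Rightarrow> ('n, 'k) mvpoly"
    assume hom: "module_hom poly_scale poly_scale \<delta>"
      and leibniz: "\<And>x y. \<delta> (x * y) = x * \<delta> y + \<delta> x * y"
    \<comment> \<open>The sequence (id, \<delta>) has length 1; its extension to infinite length is
      the integral of \<open>\<delta>\<close>.\<close>
    define E :: "nat \<Rightarrow> ('n, 'k) mvpoly \<Rightarrow> ('n, 'k) mvpoly"
      where "E i = (if i = 0 then id else if i = 1 then \<delta> else (\<lambda>_. 0))" for i
    have "E \<in> HS poly_scale 1"
      using hom by (auto simp: HS_def E_def module_hom_iff leibniz le_Suc_eq)
    then obtain E' where E': "E' \<in> HS_inf poly_scale" "\<And>i. i \<le> 1 \<Longrightarrow> E' i = E i"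
      using HS_poly_extend by blast
    have "E' 1 = \<delta>"
      using E'(2) [of 1] by (simp add: E_def)
    then show "\<exists>E\<in>HS_inf poly_scale. E 1 = \<delta>"
      using E'(1) by blast
  qed (use assms module_poly_scale in auto)
  obtain D' where D': "D' \<in> HS_inf poly_scale" "\<And>i. i \<le> p ^ l \<Longrightarrow> D' i = D i"
    using HS_poly_extend [OF assms(5)] by blast
  have p: "p > 1"
    using assms(1) by (rule prime_gt_1_nat)
  \<comment> \<open>Translates the strict bound in \<open>HS_inf_log\<close> into the inclusive one
    of \<open>logarithmic_upto\<close>.\<close>
  have less_iff: "c < p ^ k \<longleftrightarrow> c \<le> p ^ k - 1" for c k
  proof -
    have "p ^ k > 0"
      using p by simp
    then show ?thesis
      by linarith
  qed
  have "D' \<in> HS_inf_log (p ^ l) 1"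
    using D' assms(6) by (force simp: HS_inf_log_def logarithmic_upto_def less_iff)
  moreover have "D' 1 = (\<lambda>_. 0)"
    using hs_ell_gt_1_iff [of D] assms(5,7) D'(2) [of 1] p by (simp add: HS_def Suc_le_eq)
  ultimately obtain T F where T: "T \<in> HS_inf_log (p ^ (l - 1)) 1"
    and F: "F \<in> HS_inf_log (Suc (p ^ l)) 1" "F 1 = (\<lambda>_. 0)"
    and eq: "\<And>c x. c \<le> p ^ l \<Longrightarrow> D' c x = (\<Sum>i\<le>c. hs_dilate p T i (F (c - i) x))"
    using HS_inf_dilation_factor [OF _ _ assms(4)] by blast
  let ?F = "hs_truncate (p ^ l) F" and ?T = "hs_truncate (p ^ (l - 1)) T"
  show ?thesis
  proof (intro exI conjI)
    show "?F \<in> HS_log poly_scale I (p ^ l)"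
      using F(1) hs_truncate_HS [of F poly_scale "p ^ l"]
      by (auto simp: HS_log_def HS_inf_log_def logarithmic_upto_def hs_truncate_def)
    show "hs_ell ?F > 1"
      using F HS_inf_0 [OF HS_inf_logD(1) [OF F(1)]]
      by (subst hs_ell_gt_1_iff) (simp_all add: hs_truncate_def)
    show "?T \<in> HS poly_scale (p ^ (l - 1))"
      by (rule hs_truncate_HS [OF HS_inf_logD(1) [OF T]])
    show "logarithmic_upto (p ^ (l - 1) - 1) I ?T"
      using T by (auto simp: HS_inf_log_def logarithmic_upto_def hs_truncate_def less_iff)
    show "D = hs_comp (p ^ l) (hs_dilate p ?T) ?F"
    proof
      fix c
      show "D c = hs_comp (p ^ l) (hs_dilate p ?T) ?F c"
      proof (cases "c \<le> p ^ l")
        case True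
        \<comment> \<open>Only entries of \<open>T\<close> up to index p^(l - 1) occur, and these
          are unchanged by truncation.\<close>
        have "hs_dilate p ?T i = hs_dilate p T i" if "i \<le> c" for i
        proof -
          have "p ^ l = p * p ^ (l - 1)"
            using assms(4) by (simp flip: power_Suc)
          then have "i div p \<le> p ^ (l - 1)"
            using that True p by (metis div_le_mono le_trans nonzero_mult_div_cancel_left not_one_less_zero)
          then show ?thesis
            by (simp add: hs_dilate_def hs_truncate_def)
        qed
        moreover have le: "c - i \<le> p ^ l" for i
          using True by linarith
        ultimately show ?thesis
          using True D'(2) [OF True, symmetric]
          by (simp add: hs_comp_def hs_truncate_def eq le fun_eq_iff)
      next
        case False
        then show ?thesis
          using assms(5) by (simp add: HS_def hs_comp_def)
      qed
    qed
  qed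
qed

end
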